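(* Let $w\in\{a,b\}^{\mathbb{Z}}$ be a bi-infinite word obtained by the inductive construction described in the context. Then the suspension space $\Omega_w$ associated with $w$ has finitely generated (Čech) cohomology over $\mathbb{Q}$.
   Context: $|f|$ denotes the length of a finite word $f$. Construction of $w$. Choose a finite word $f_1$ over $\{a,b\}$ in which all words of length $2$ over $\{a,b\}$ appear as factors, except $aa$ (which does not appear). Put $u_1=aab\,f_1\,baa$ and $v_1=abb\,f_1\,baa$. Inductively, given $u_k,v_k$ of the same length, choose a finite word over $\{0,1\}$ not containing $00$ and in which every word of length $|u_k|$ over $\{0,1\}$ not containing $00$ appears as a factor; apply to it the substitution $0\mapsto u_k$, $1\mapsto v_k$, and call $f_{k+1}$ the resulting word over $\{a,b\}$. Put $$u_{k+1}=u_ku_kv_kf_{k+1}v_ku_ku_k,\qquad v_{k+1}=u_kv_kv_kf_{k+1}v_ku_ku_k .$$ For every $k$, $u_k$ appears in $f_{k+1}$, hence in the middle of $u_{k+1}$. For each $k$ choose an occurrence of $u_k$ in the factor $f_{k+1}$ of $u_{k+1}$; this makes $(u_k)_{k\ge1}$ a sequence of finite words increasing on both ends, and $w$ is the bi-infinite word which is its limit (increasing union). Suspension: with the shift $\tau(x)_i=x_{i+1}$ on $\{a,b\}^{\mathbb{Z}}$ (product topology), $\Theta_w$ is the closure of $\{\tau^n(w): n\in\mathbb{Z}\}$, and $\Omega_w=\Theta_w\times\mathbb{R}/\sim$, where $\sim$ is generated by $(x,t)\sim(\tau(x),t-1)$; a basis of open sets is given by $U(V,I)=\{[(x,t)]: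 x\in V,\ t\in I\}$ with $V\subseteq\Theta_w$ open and $I\subseteq\mathbb{R}$ an open interval. *)

theory Defs
  imports
    "HOL-Analysis.Analysis"
    "HOL-Algebra.Module"
    "HOL-Algebra.Algebraic_Closure_Type"
    "HOL-Library.Sublist"
begin

section \<open>The words\<close>

datatype letter = La | Lb

text \<open>The alphabet \<open>{0, 1}\<close> is \<^typ>\<open>bool\<close>, with \<^const>\<open>False\<close> for \<open>0\<close>. Factors are contiguous
  subwords, i.e. \<^const>\<open>sublist\<close>.\<close>

definition substitute :: "'a list \<Rightarrow> 'a list \<Rightarrow> bool list \<Rightarrow> 'a list" where
  "substitute u v g = concat (map (\<lambda>d. if d then v else u) g)"

definition no_00 :: "bool list \<Rightarrow> bool" where
  "no_00 x \<longleftrightarrow> \<not> sublist [False, False] x"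

text \<open>Only the indices \<open>k \<ge> 1\<close> are used; \<open>g k\<close> is the word over \<open>{0, 1}\<close> whose image under the
  substitution is \<open>f (k + 1)\<close>.\<close>

definition word_construction ::
  "(nat \<Rightarrow> letter list) \<Rightarrow> (nat \<Rightarrow> letter list) \<Rightarrow> (nat \<Rightarrow> letter list) \<Rightarrow> (nat \<Rightarrow> bool list) \<Rightarrow> bool"
where
  "word_construction f u v g \<longleftrightarrow>
     (\<forall>x y. sublist [x, y] (f 1) \<longleftrightarrow> [x, y] \<noteq> [La, La]) \<and>
     u 1 = [La, La, Lb] @ f 1 @ [Lb, La, La] \<and>
     v 1 = [La, Lb, Lb] @ f 1 @ [Lb, La, La] \<and>
     (\<forall>k\<ge>1.
        no_00 (g k) \<and>
        (\<forall>x. length x = length (u k) \<and> no_00 x \<longrightarrow> sublist x (g k)) \<and>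
        f (Suc k) = substitute (u k) (v k) (g k) \<and>
        u (Suc k) = u k @ u k @ v k @ f (Suc k) @ v k @ u k @ u k \<and>
        v (Suc k) = u k @ v k @ v k @ f (Suc k) @ v k @ u k @ u k)"

text \<open>The chosen occurrence of \<open>u k\<close> in \<open>f (k + 1)\<close> is recorded by the factor \<open>p k\<close> preceding it.
  It starts at offset \<open>|u k u k v k| + |p k|\<close> of \<open>u (k + 1)\<close>. In the limit word, \<open>u k\<close> occupies the
  positions from \<open>pos k\<close> on; \<open>pos 1\<close> is arbitrary, as the union is defined only up to the choice
  of an origin. Both ends of \<open>u k\<close> move strictly outwards, so \<open>w\<close> is determined by \<open>pos 1\<close>.\<close>

definition constructed_word :: "(int \<Rightarrow> letter) \<Rightarrow> bool" where
  "constructed_word w \<longleftrightarrow>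
     (\<exists>f u v g p s pos.
        word_construction f u v g \<and>
        (\<forall>k\<ge>1. f (Suc k) = p k @ u k @ s k) \<and>
        (\<forall>k\<ge>1. pos k = pos (Suc k) + int (length (u k @ u k @ v k @ p k))) \<and>
        (\<forall>k\<ge>1. \<forall>i<length (u k). w (pos k + int i) = u k ! i))"


section \<open>The suspension space\<close>

definition shift :: "(int \<Rightarrow> 'a) \<Rightarrow> int \<Rightarrow> 'a" where
  "shift x = (\<lambda>i. x (i + 1))"

definition full_shift :: "(int \<Rightarrow> 'a) topology" where
  "full_shift = product_topology (\<lambda>_. discrete_topology UNIV) UNIV"

text \<open>The set comprehension is the two-sided orbit: the \<open>n\<close>-th power of the shift maps \<open>w\<close> to
  \<open>\<lambda>i. w (i + n)\<close>.\<close>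

definition Theta :: "(int \<Rightarrow> 'a) \<Rightarrow> (int \<Rightarrow> 'a) set" where
  "Theta w = full_shift closure_of {(\<lambda>i. w (i + n)) | n :: int. True}"

definition suspension_step ::
  "(int \<Rightarrow> 'a) \<Rightarrow> (int \<Rightarrow> 'a) \<times> real \<Rightarrow> (int \<Rightarrow> 'a) \<times> real \<Rightarrow> bool" where
  "suspension_step w a b \<longleftrightarrow> fst a \<in> Theta w \<and> b = (shift (fst a), snd a - 1)"

definition suspension_class ::
  "(int \<Rightarrow> 'a) \<Rightarrow> (int \<Rightarrow> 'a) \<times> real \<Rightarrow> ((int \<Rightarrow> 'a) \<times> real) set" where
  "suspension_class w a = {b. equivclp (suspension_step w) a b}"

definition suspension_base :: "(int \<Rightarrow> 'a) \<Rightarrow> ((int \<Rightarrow> 'a) \<times> real) set set set" where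
  "suspension_base w =
     {suspension_class w ` (V \<times> I) | V I.
        openin (subtopology full_shift (Theta w)) V \<and> open I \<and> is_interval I}"

definition Omega :: "(int \<Rightarrow> 'a) \<Rightarrow> ((int \<Rightarrow> 'a) \<times> real) set topology" where
  "Omega w = topology_generated_by (suspension_base w)"


section \<open>Cech cohomology with rational coefficients\<close>

definition open_cover :: "'a topology \<Rightarrow> 'a set set \<Rightarrow> bool" where
  "open_cover T \<U> \<longleftrightarrow> (\<forall>U\<in>\<U>. openin T U) \<and> \<Union>\<U> = topspace T"

definition refinement_map :: "'a set set \<Rightarrow> 'a set set \<Rightarrow> ('a set \<Rightarrow> 'a set) \<Rightarrow> bool" where
  "refinement_map \<V> \<U> p \<longleftrightarrow> (\<forall>V\<in>\<V>. p V \<in> \<U> \<and> V \<subseteq> p V)"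

text \<open>Ordered \<open>n\<close>-simplices of the nerve, repeated vertices allowed.\<close>

definition nerve_simplices :: "'a set set \<Rightarrow> nat \<Rightarrow> 'a set list set" where
  "nerve_simplices \<U> n = {s. length s = Suc n \<and> set s \<subseteq> \<U> \<and> \<Inter>(set s) \<noteq> {}}"

text \<open>Simplicial cochains of the nerve: alternating functions on ordered simplices, extended by \<open>0\<close>
  to all other lists. Alternation forces the value \<open>0\<close> on simplices with a repeated vertex.\<close>

definition cochains :: "'a set set \<Rightarrow> nat \<Rightarrow> ('a set list \<Rightarrow> rat) set" where
  "cochains \<U> n = {c.
     (\<forall>s. s \<notin> nerve_simplices \<U> n \<longrightarrow> c s = 0) \<and>
     (\<forall>s\<in>nerve_simplices \<U> n. \<forall>i\<le>n. \<forall>j\<le>n. i \<noteq> j \<longrightarrow> c (s[i := s ! j, j := s ! i]) = - c s)}"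

definition coboundary ::
  "'a set set \<Rightarrow> nat \<Rightarrow> ('a set list \<Rightarrow> rat) \<Rightarrow> 'a set list \<Rightarrow> rat" where
  "coboundary \<U> n c s =
     (if s \<in> nerve_simplices \<U> (Suc n)
      then \<Sum>i\<le>Suc n. (-1) ^ i * c (take i s @ drop (Suc i) s) else 0)"

definition cocycles :: "'a set set \<Rightarrow> nat \<Rightarrow> ('a set list \<Rightarrow> rat) set" where
  "cocycles \<U> n = {c \<in> cochains \<U> n. coboundary \<U> n c = (\<lambda>_. 0)}"

definition coboundaries :: "'a set set \<Rightarrow> nat \<Rightarrow> ('a set list \<Rightarrow> rat) set" where
  "coboundaries \<U> n =
     (case n of 0 \<Rightarrow> {\<lambda>_. 0} | Suc m \<Rightarrow> coboundary \<U> m ` cochains \<U> m)"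

definition pull_cochain ::
  "'a set set \<Rightarrow> nat \<Rightarrow> ('a set \<Rightarrow> 'a set) \<Rightarrow> ('a set list \<Rightarrow> rat) \<Rightarrow> 'a set list \<Rightarrow> rat" where
  "pull_cochain \<V> n p c s = (if s \<in> nerve_simplices \<V> n then c (map p s) else 0)"

text \<open>The \<open>n\<close>-th Cech cohomology is the direct limit, over open covers directed by refinement, of
  the cohomology of the nerves. Its elements are represented by a cover together with a cocycle of
  its nerve; two such represent the same element iff their pullbacks are cohomologous on a common
  refinement. (The class of a pullback does not depend on the refinement map.)\<close>

definition cech_cocycles :: "'a topology \<Rightarrow> nat \<Rightarrow> ('a set set \<times> ('a set list \<Rightarrow> rat)) set" where
  "cech_cocycles T n = {(\<U>, z). open_cover T \<U> \<and> z \<in> cocycles \<U> n}"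

definition cech_rel ::
  "'a topology \<Rightarrow> nat \<Rightarrow>
     (('a set set \<times> ('a set list \<Rightarrow> rat)) \<times> ('a set set \<times> ('a set list \<Rightarrow> rat))) set" where
  "cech_rel T n = {((\<U>, y), (\<V>, z)).
     (\<U>, y) \<in> cech_cocycles T n \<and> (\<V>, z) \<in> cech_cocycles T n \<and>
     (\<exists>\<W> p q. open_cover T \<W> \<and> refinement_map \<W> \<U> p \<and> refinement_map \<W> \<V> q \<and>
        (\<lambda>s. pull_cochain \<W> n p y s - pull_cochain \<W> n q z s) \<in> coboundaries \<W> n)}"

text \<open>Any two elements have representatives on the same cover, and the operations are defined on
  such representatives. The multiplicative fields of the record play no role in a module.\<close>

definition cech_cohomology ::
  "'a topology \<Rightarrow> nat \<Rightarrow> (rat, ('a set set \<times> ('a set list \<Rightarrow> rat)) set) module" where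
  "cech_cohomology T n =
     \<lparr>carrier = cech_cocycles T n // cech_rel T n,
      monoid.mult = undefined,
      one = undefined,
      zero = cech_rel T n `` {({topspace T}, \<lambda>_. 0)},
      add = (\<lambda>A B. \<Union>{cech_rel T n `` {(\<U>, \<lambda>s. y s + z s)} | \<U> y z. (\<U>, y) \<in> A \<and> (\<U>, z) \<in> B}),
      smult = (\<lambda>r A. \<Union>{cech_rel T n `` {(\<U>, \<lambda>s. r * y s)} | \<U> y. (\<U>, y) \<in> A})\<rparr>"

definition direct_sum_module :: "(nat \<Rightarrow> ('r, 'm) module) \<Rightarrow> ('r, nat \<Rightarrow> 'm) module" where
  "direct_sum_module M =
     \<lparr>carrier = {x. (\<forall>n. x n \<in> carrier (M n)) \<and> finite {n. x n \<noteq> \<zero>\<^bsub>M n\<^esub>}},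
      monoid.mult = undefined,
      one = undefined,
      zero = (\<lambda>n. \<zero>\<^bsub>M n\<^esub>),
      add = (\<lambda>x y n. x n \<oplus>\<^bsub>M n\<^esub> y n),
      smult = (\<lambda>r x n. r \<odot>\<^bsub>M n\<^esub> x n)\<rparr>"

definition total_cech_cohomology ::
  "'a topology \<Rightarrow> (rat, nat \<Rightarrow> ('a set set \<times> ('a set list \<Rightarrow> rat)) set) module" where
  "total_cech_cohomology T = direct_sum_module (cech_cohomology T)"

definition finitely_generated_module :: "('r, 'e) ring_scheme \<Rightarrow> ('r, 'm) module \<Rightarrow> bool" where
  "finitely_generated_module R M \<longleftrightarrow>
     (\<exists>S. finite S \<and> S \<subseteq> carrier M \<and>
        (\<forall>H. submodule H R M \<and> S \<subseteq> H \<longrightarrow> H = carrier M))"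

end

(* The cohomology of the suspension is controlled by covers by flow boxes: a cylinder of words that
   agree on a window, times an interval of length 2/m centred at a multiple of 1/m. Such covers are
   cofinal by compactness, a point lies in at most two of the boxes, and all intersections
   occur between consecutive boxes along the orbit of w. So the nerves are graphs, the cohomology
   vanishes in degrees at least 2 and is one-dimensional in degree 0.

   A 1-cocycle gives a function phi on the integers with phi n depending only on a window of w around
   n, and it is a coboundary on a finer cover as soon as phi n = psi (n + 1) - psi n for such a
   function psi. Since u (k + 1) and v (k + 1) begin and end with u k, for large k the sum of phi over
   an occurrence of one of them depends only on which of the two it is. Three functions therefore have
   a nontrivial combination whose sums over all these blocks vanish, so that its partial sums take
   finitely many values; as w is uniformly recurrent, the argument of Gottschalk and Hedlund makes
   them local. Hence the first cohomology has dimension at most 2. *)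
theory Submission
  imports Defs
begin

section \<open>Cech cohomology and refinements\<close>

text \<open>Classes in a direct limit can be compared only if pulling back does not depend on the
  refinement map. In degrees 0 and 1 this comes from an explicit homotopy, for every space; in
  higher degrees it is a by-product of the box covers, which carry no nonzero cochains there.

  Boxes are indexed by integers: the index \<open>i\<close> stands for the point that the flow
  reaches from \<open>w\<close> after time \<open>i / m\<close>. Summing a 1-cochain over the
  \<open>m\<close> edges between the times \<open>n\<close> and \<open>n + 1\<close> turns it into
  \<phi>. A primitive found on the integers is interpolated back to the boxes in between, so the
  final refinement enlarges the window and keeps \<open>m\<close>.

  The bound 2 counts block types: each imposes one linear equation. Equal lengths of the two words
  let one \<open>L\<close> tile every long stretch. The common borders are needed because \<phi>
  looks \<open>R\<close> letters to either side, so its sum over a block also sees letters outside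
  the block; a border \<open>u k\<close> of length at least \<open>R\<close> fixes those
  letters.\<close>

lemma nerve_simplices_map:
  assumes "refinement_map \<W> \<U> p" "s \<in> nerve_simplices \<W> n"
  shows "map p s \<in> nerve_simplices \<U> n"
proof -
  have "set s \<subseteq> \<W>" "\<Inter>(set s) \<noteq> {}" "length s = Suc n"
    using assms(2) by (auto simp: nerve_simplices_def)
  moreover from this have "\<Inter>(set s) \<subseteq> \<Inter>(set (map p s))"
    using assms(1) unfolding refinement_map_def by fastforce
  ultimately show ?thesis
    using assms(1) unfolding refinement_map_def nerve_simplices_def by auto
qed

lemma nerve_simplices_face:
  assumes "s \<in> nerve_simplices \<U> (Suc n)" "i \<le> Suc n"
  shows "take i s @ drop (Suc i) s \<in> nerve_simplices \<U> n"
proof -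
  have "set (take i s @ drop (Suc i) s) \<subseteq> set s"
    by (auto dest: in_set_takeD in_set_dropD)
  moreover from this have "\<Inter>(set s) \<subseteq> \<Inter>(set (take i s @ drop (Suc i) s))"
    by (rule Inter_anti_mono)
  ultimately show ?thesis
    using assms unfolding nerve_simplices_def by auto
qed

lemma nerve_simplices_swap:
  assumes "s \<in> nerve_simplices \<U> n" "i \<le> n" "j \<le> n"
  shows "s[i := s ! j, j := s ! i] \<in> nerve_simplices \<U> n"
proof -
  have "set (s[i := s ! j, j := s ! i]) = set s"
    using assms by (intro set_swap) (auto simp: nerve_simplices_def)
  then show ?thesis
    using assms by (simp add: nerve_simplices_def)
qed

lemma cochains_eq_0: "c \<in> cochains \<U> n \<Longrightarrow> s \<notin> nerve_simplices \<U> n \<Longrightarrow> c s = 0"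
  by (simp add: cochains_def)

lemma cochains_swap:
  "c \<in> cochains \<U> n \<Longrightarrow> s \<in> nerve_simplices \<U> n \<Longrightarrow> i \<le> n \<Longrightarrow> j \<le> n \<Longrightarrow> i \<noteq> j
    \<Longrightarrow> c (s[i := s ! j, j := s ! i]) = - c s"
  by (simp add: cochains_def)

lemma zero_in_cochains [simp]: "(\<lambda>_. 0) \<in> cochains \<U> n"
  by (simp add: cochains_def)

lemma cochains_lincomb:
  assumes "c \<in> cochains \<U> n" "d \<in> cochains \<U> n"
  shows "(\<lambda>s. a * c s + b * d s) \<in> cochains \<U> n"
  using assms unfolding cochains_def by (simp add: algebra_simps)

lemma coboundary_lincomb:
  "coboundary \<U> n (\<lambda>s. a * c s + b * d s) = (\<lambda>s. a * coboundary \<U> n c s + b * coboundary \<U> n d s)"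
  by (rule ext) (simp add: coboundary_def sum.distrib sum_distrib_left algebra_simps)

lemma coboundary_zero [simp]: "coboundary \<U> n (\<lambda>_. 0) = (\<lambda>_. 0)"
  by (rule ext) (simp add: coboundary_def)

lemma zero_in_cocycles [simp]: "(\<lambda>_. 0) \<in> cocycles \<U> n"
  by (simp add: cocycles_def)

lemma cocycles_lincomb:
  assumes "c \<in> cocycles \<U> n" "d \<in> cocycles \<U> n"
  shows "(\<lambda>s. a * c s + b * d s) \<in> cocycles \<U> n"
  using assms unfolding cocycles_def by (simp add: cochains_lincomb coboundary_lincomb)

lemma coboundaries_lincomb:
  assumes "c \<in> coboundaries \<U> n" "d \<in> coboundaries \<U> n"
  shows "(\<lambda>s. a * c s + b * d s) \<in> coboundaries \<U> n"
proof (cases n)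
  case 0
  then show ?thesis using assms by (simp add: coboundaries_def)
next
  case (Suc m)
  then obtain c' d' where "c' \<in> cochains \<U> m" "c = coboundary \<U> m c'"
    "d' \<in> cochains \<U> m" "d = coboundary \<U> m d'"
    using assms by (auto simp: coboundaries_def)
  then have "(\<lambda>s. a * c s + b * d s) = coboundary \<U> m (\<lambda>s. a * c' s + b * d' s)"
    "(\<lambda>s. a * c' s + b * d' s) \<in> cochains \<U> m"
    by (simp_all add: coboundary_lincomb cochains_lincomb)
  then show ?thesis
    using Suc by (simp add: coboundaries_def)
qed

lemma zero_in_coboundaries [simp]: "(\<lambda>_. 0) \<in> coboundaries \<U> n"
proof (cases n)
  case (Suc m)
  have "coboundary \<U> m (\<lambda>_. 0) \<in> coboundary \<U> m ` cochains \<U> m"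
    by (intro imageI) simp
  then show ?thesis
    using Suc by (simp add: coboundaries_def)
qed (simp add: coboundaries_def)

lemma pull_cochain_lincomb:
  "pull_cochain \<W> n p (\<lambda>s. a * c s + b * d s)
    = (\<lambda>s. a * pull_cochain \<W> n p c s + b * pull_cochain \<W> n p d s)"
  by (rule ext) (simp add: pull_cochain_def)

lemma pull_cochain_zero [simp]: "pull_cochain \<W> n p (\<lambda>_. 0) = (\<lambda>_. 0)"
  by (rule ext) (simp add: pull_cochain_def)

lemma pull_cochain_id:
  "c \<in> cochains \<U> n \<Longrightarrow> pull_cochain \<U> n id c = c"
  by (rule ext) (simp add: pull_cochain_def cochains_def)

lemma pull_cochain_comp:
  assumes "refinement_map \<V> \<W> q"
  shows "pull_cochain \<V> n q (pull_cochain \<W> n p c) = pull_cochain \<V> n (p \<circ> q) c"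
  by (rule ext) (simp add: pull_cochain_def nerve_simplices_map[OF assms])

lemma pull_cochain_cochains:
  assumes p: "refinement_map \<W> \<U> p" and c: "c \<in> cochains \<U> n"
  shows "pull_cochain \<W> n p c \<in> cochains \<W> n"
proof -
  have "pull_cochain \<W> n p c (s[i := s ! j, j := s ! i]) = - pull_cochain \<W> n p c s"
    if s: "s \<in> nerve_simplices \<W> n" and ij: "i \<le> n" "j \<le> n" "i \<noteq> j" for s i j
  proof -
    have "i < length s" "j < length s"
      using s ij by (auto simp: nerve_simplices_def)
    then have "map p (s[i := s ! j, j := s ! i]) = (map p s)[i := map p s ! j, j := map p s ! i]"
      by (simp add: map_update)
    then show ?thesis
      using cochains_swap[OF c nerve_simplices_map[OF p s] ij] s nerve_simplices_swap[OF s ij(1,2)]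
      by (simp add: pull_cochain_def)
  qed
  then show ?thesis
    by (simp add: cochains_def pull_cochain_def)
qed

lemma coboundary_pull_cochain:
  assumes p: "refinement_map \<W> \<U> p"
  shows "coboundary \<W> n (pull_cochain \<W> n p c) = pull_cochain \<W> (Suc n) p (coboundary \<U> n c)"
proof
  fix s
  show "coboundary \<W> n (pull_cochain \<W> n p c) s = pull_cochain \<W> (Suc n) p (coboundary \<U> n c) s"
  proof (cases "s \<in> nerve_simplices \<W> (Suc n)")
    case True
    have "pull_cochain \<W> n p c (take i s @ drop (Suc i) s)
        = c (take i (map p s) @ drop (Suc i) (map p s))" if "i \<le> Suc n" for i
      using nerve_simplices_face[OF True that] by (simp add: pull_cochain_def take_map drop_map)
    then show ?thesis
      using True nerve_simplices_map[OF p True] by (simp add: coboundary_def pull_cochain_def)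
  qed (simp add: coboundary_def pull_cochain_def)
qed

lemma pull_cochain_cocycles:
  assumes "refinement_map \<W> \<U> p" "c \<in> cocycles \<U> n"
  shows "pull_cochain \<W> n p c \<in> cocycles \<W> n"
  using assms pull_cochain_cochains coboundary_pull_cochain unfolding cocycles_def by fastforce

lemma pull_cochain_coboundaries:
  assumes "refinement_map \<W> \<U> p" "c \<in> coboundaries \<U> n"
  shows "pull_cochain \<W> n p c \<in> coboundaries \<W> n"
proof (cases n)
  case 0
  then show ?thesis using assms by (simp add: coboundaries_def)
next
  case (Suc m)
  then obtain d where "d \<in> cochains \<U> m" "c = coboundary \<U> m d"
    using assms by (auto simp: coboundaries_def)
  then show ?thesis
    using Suc coboundary_pull_cochain[OF assms(1)] pull_cochain_cochains[OF assms(1)]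
    by (auto simp: coboundaries_def image_iff) metis
qed

lemma refinement_map_comp:
  "refinement_map \<V> \<W> q \<Longrightarrow> refinement_map \<W> \<U> p \<Longrightarrow> refinement_map \<V> \<U> (p \<circ> q)"
  unfolding refinement_map_def by fastforce

lemma refinement_map_id [simp]: "refinement_map \<U> \<U> id"
  by (simp add: refinement_map_def)

lemma refinement_map_ex:
  assumes "\<And>V. V \<in> \<V> \<Longrightarrow> \<exists>U\<in>\<U>. V \<subseteq> U"
  obtains p where "refinement_map \<V> \<U> p"
  using assms unfolding refinement_map_def by metis

lemma open_cover_common_refinement:
  assumes "open_cover T \<U>" "open_cover T \<V>"
  obtains \<W> p q where "open_cover T \<W>" "refinement_map \<W> \<U> p" "refinement_map \<W> \<V> q"
proof -
  define \<W> where "\<W> = {U \<inter> V | U V. U \<in> \<U> \<and> V \<in> \<V>}"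
  have "open_cover T \<W>"
    using assms unfolding open_cover_def \<W>_def by blast
  moreover obtain p where "refinement_map \<W> \<U> p"
    by (rule refinement_map_ex[of \<W> \<U>]) (auto simp: \<W>_def)
  moreover obtain q where "refinement_map \<W> \<V> q"
    by (rule refinement_map_ex[of \<W> \<V>]) (auto simp: \<W>_def)
  ultimately show thesis using that by blast
qed

section \<open>Null classes and independence of the refinement map\<close>

definition cech_null :: "'a topology \<Rightarrow> nat \<Rightarrow> 'a set set \<Rightarrow> ('a set list \<Rightarrow> rat) \<Rightarrow> bool" where
  "cech_null T n \<U> c \<longleftrightarrow>
     (\<exists>\<W> p. open_cover T \<W> \<and> refinement_map \<W> \<U> p \<and> pull_cochain \<W> n p c \<in> coboundaries \<W> n)"

text \<open>Kept as a property of a space and a degree, because it is established in different ways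
  in low and in high degrees. The difference of the two pullbacks need only become a coboundary
  after a further refinement, which is all that the limit sees.\<close>

definition refinement_independent :: "'a topology \<Rightarrow> nat \<Rightarrow> bool" where
  "refinement_independent T n \<longleftrightarrow>
     (\<forall>\<U> \<W> c p q. open_cover T \<U> \<longrightarrow> open_cover T \<W> \<longrightarrow> c \<in> cocycles \<U> n \<longrightarrow>
        refinement_map \<W> \<U> p \<longrightarrow> refinement_map \<W> \<U> q \<longrightarrow>
        cech_null T n \<W> (\<lambda>s. pull_cochain \<W> n p c s - pull_cochain \<W> n q c s))"

lemma nerve_simplices_0: "s \<in> nerve_simplices \<U> 0 \<longleftrightarrow> (\<exists>A\<in>\<U>. A \<noteq> {} \<and> s = [A])"
  by (auto simp: nerve_simplices_def length_Suc_conv)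

lemma nerve_simplices_1:
  "s \<in> nerve_simplices \<U> (Suc 0) \<longleftrightarrow> (\<exists>A\<in>\<U>. \<exists>B\<in>\<U>. A \<inter> B \<noteq> {} \<and> s = [A, B])"
  by (auto simp: nerve_simplices_def length_Suc_conv)

lemma nerve_simplices_2:
  "s \<in> nerve_simplices \<U> (Suc (Suc 0)) \<longleftrightarrow>
    (\<exists>A\<in>\<U>. \<exists>B\<in>\<U>. \<exists>C\<in>\<U>. A \<inter> B \<inter> C \<noteq> {} \<and> s = [A, B, C])"
  by (auto simp: nerve_simplices_def length_Suc_conv Int_assoc)

lemma cochains_0_iff: "c \<in> cochains \<U> 0 \<longleftrightarrow> (\<forall>s. s \<notin> nerve_simplices \<U> 0 \<longrightarrow> c s = 0)"
  by (auto simp: cochains_def)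

lemma coboundary_0_eq: "[A, B] \<in> nerve_simplices \<U> (Suc 0) \<Longrightarrow> coboundary \<U> 0 c [A, B] = c [B] - c [A]"
  by (simp add: coboundary_def)

lemma coboundary_1_eq: "[A, B, C] \<in> nerve_simplices \<U> (Suc (Suc 0)) \<Longrightarrow>
    coboundary \<U> (Suc 0) c [A, B, C] = c [B, C] - c [A, C] + c [A, B]"
  by (simp add: coboundary_def numeral_2_eq_2 eval_nat_numeral)

lemma cech_nullI: "open_cover T \<U> \<Longrightarrow> c \<in> cochains \<U> n \<Longrightarrow> c \<in> coboundaries \<U> n \<Longrightarrow> cech_null T n \<U> c"
  unfolding cech_null_def using pull_cochain_id refinement_map_id by metis

lemma cocycles_0_eq:
  assumes c: "c \<in> cocycles \<U> 0" and AB: "A \<in> \<U>" "B \<in> \<U>" "A \<inter> B \<noteq> {}"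
  shows "c [A] = c [B]"
proof -
  have "[A, B] \<in> nerve_simplices \<U> (Suc 0)"
    using AB by (auto simp: nerve_simplices_1)
  then have "coboundary \<U> 0 c [A, B] = c [B] - c [A]"
    by (rule coboundary_0_eq)
  then show ?thesis using c by (simp add: cocycles_def)
qed

text \<open>Both \<open>p A\<close> and \<open>q A\<close> contain the nonempty set
  \<open>A\<close>, so they span an edge of the nerve, along which a 0-cocycle is constant.\<close>

lemma refinement_independent_0: "refinement_independent T 0"
  unfolding refinement_independent_def
proof (intro allI impI)
  fix \<U> \<W> c p q
  assume *: "open_cover T \<U>" "open_cover T \<W>" "c \<in> cocycles \<U> 0"
    "refinement_map \<W> \<U> p" "refinement_map \<W> \<U> q"
  have "pull_cochain \<W> 0 p c s = pull_cochain \<W> 0 q c s" for s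
  proof (cases "s \<in> nerve_simplices \<W> 0")
    case True
    then obtain A where A: "A \<in> \<W>" "A \<noteq> {}" "s = [A]"
      by (auto simp: nerve_simplices_0)
    have sub: "p A \<in> \<U>" "q A \<in> \<U>" "A \<subseteq> p A" "A \<subseteq> q A"
      using A * by (auto simp: refinement_map_def)
    have "c [p A] = c [q A]"
      by (rule cocycles_0_eq[OF *(3)]) (use A sub in blast)+
    then show ?thesis using A True by (simp add: pull_cochain_def)
  qed (simp add: pull_cochain_def)
  then show "cech_null T 0 \<W> (\<lambda>s. pull_cochain \<W> 0 p c s - pull_cochain \<W> 0 q c s)"
    using * by (simp add: cech_nullI)
qed

text \<open>The homotopy between the two refinement maps sends a vertex \<open>A\<close> to the edge
  from \<open>p A\<close> to \<open>q A\<close>. The cocycle identity on the triangles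
  \<open>p A, p B, q B\<close> and \<open>p A, q A, q B\<close>, whose vertices all contain
  \<open>A \<inter> B\<close>, gives the claim after subtraction.\<close>

lemma refinement_independent_1: "refinement_independent T (Suc 0)"
  unfolding refinement_independent_def
proof (intro allI impI)
  fix \<U> \<W> c p q
  assume *: "open_cover T \<U>" "open_cover T \<W>" "c \<in> cocycles \<U> (Suc 0)"
    "refinement_map \<W> \<U> p" "refinement_map \<W> \<U> q"
  define h where "h s = (if s \<in> nerve_simplices \<W> 0 then - c [p (s ! 0), q (s ! 0)] else 0)" for s
  define d where "d = (\<lambda>s. pull_cochain \<W> (Suc 0) p c s - pull_cochain \<W> (Suc 0) q c s)"
  have cyc: "c [B, C] - c [A, C] + c [A, B] = 0"
    if "A \<in> \<U>" "B \<in> \<U>" "C \<in> \<U>" "A \<inter> B \<inter> C \<noteq> {}" for A B C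
    using coboundary_1_eq[of A B C \<U> c] that *(3) by (auto simp: cocycles_def nerve_simplices_2)
  have "d s = coboundary \<W> 0 h s" for s
  proof (cases "s \<in> nerve_simplices \<W> (Suc 0)")
    case True
    then obtain A B where AB: "A \<in> \<W>" "B \<in> \<W>" "A \<inter> B \<noteq> {}" "s = [A, B]"
      by (auto simp: nerve_simplices_1)
    have sub: "A \<subseteq> p A" "A \<subseteq> q A" "B \<subseteq> p B" "B \<subseteq> q B" "p A \<in> \<U>" "q A \<in> \<U>" "p B \<in> \<U>" "q B \<in> \<U>"
      using * AB by (auto simp: refinement_map_def)
    have "c [p B, q B] - c [p A, q B] + c [p A, p B] = 0"
      "c [q A, q B] - c [p A, q B] + c [p A, q A] = 0"
      by (rule cyc; use AB sub in blast)+
    moreover have "h [A] = - c [p A, q A]" "h [B] = - c [p B, q B]"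
      using AB by (auto simp: h_def nerve_simplices_0)
    ultimately show ?thesis
      using True AB by (simp add: d_def pull_cochain_def coboundary_0_eq)
  qed (simp add: d_def pull_cochain_def coboundary_def)
  then have "d = coboundary \<W> 0 h" by blast
  moreover have "h \<in> cochains \<W> 0"
    by (simp add: cochains_0_iff h_def)
  ultimately have "d \<in> coboundaries \<W> (Suc 0)"
    by (simp add: coboundaries_def)
  moreover have "d \<in> cochains \<W> (Suc 0)"
    using cochains_lincomb[of "pull_cochain \<W> (Suc 0) p c" \<W> "Suc 0" "pull_cochain \<W> (Suc 0) q c" 1 "-1"]
      pull_cochain_cochains * unfolding d_def cocycles_def by fastforce
  ultimately show "cech_null T (Suc 0) \<W> (\<lambda>s. pull_cochain \<W> (Suc 0) p c s - pull_cochain \<W> (Suc 0) q c s)"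
    using * by (simp add: cech_nullI d_def)
qed

lemma cech_null_if_trivial_refinement:
  assumes "open_cover T \<W>" "refinement_map \<W> \<U> p" "cochains \<W> n \<subseteq> {\<lambda>_. 0}" "c \<in> cochains \<U> n"
  shows "cech_null T n \<U> c"
  using pull_cochain_cochains[OF assms(2,4)] assms unfolding cech_null_def
  by (metis zero_in_coboundaries singletonD subsetD)

text \<open>If every cover has a refinement without nonzero \<open>n\<close>-cochains, then the
  difference of the two pullbacks dies there. This replaces a homotopy formula in higher
  degrees.\<close>

lemma refinement_independent_if_trivial_refinements:
  assumes "\<And>\<U>. open_cover T \<U> \<Longrightarrow> \<exists>\<W> p. open_cover T \<W> \<and> refinement_map \<W> \<U> p \<and> cochains \<W> n \<subseteq> {\<lambda>_. 0}"
  shows "refinement_independent T n"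
  unfolding refinement_independent_def
proof (intro allI impI)
  fix \<U> \<W> c p q
  assume *: "open_cover T \<U>" "open_cover T \<W>" "c \<in> cocycles \<U> n"
    "refinement_map \<W> \<U> p" "refinement_map \<W> \<U> q"
  have "(\<lambda>s. pull_cochain \<W> n p c s - pull_cochain \<W> n q c s) \<in> cochains \<W> n"
    using cochains_lincomb[of "pull_cochain \<W> n p c" \<W> n "pull_cochain \<W> n q c" 1 "-1"]
      pull_cochain_cochains * unfolding cocycles_def by fastforce
  then show "cech_null T n \<W> (\<lambda>s. pull_cochain \<W> n p c s - pull_cochain \<W> n q c s)"
    using cech_null_if_trivial_refinement assms[OF *(2)] by blast
qed

section \<open>The Cech group of one degree and its operations\<close>

locale cech_degree =
  fixes T :: "'a topology" and n :: nat
  assumes indep: "refinement_independent T n"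
begin

text \<open>The refinement that kills \<open>c\<close> need not refine \<open>\<V>\<close>. On a
  common refinement \<open>\<X>\<close> the two routes to \<open>\<U>\<close> give pullbacks with
  null difference, and the one through \<open>\<W>\<close> is already a coboundary.\<close>

lemma null_pull:
  assumes null: "cech_null T n \<U> c" and c: "c \<in> cocycles \<U> n" and U: "open_cover T \<U>"
    and V: "open_cover T \<V>" and q: "refinement_map \<V> \<U> q"
  shows "cech_null T n \<V> (pull_cochain \<V> n q c)"
proof -
  obtain \<W> p where W: "open_cover T \<W>" "refinement_map \<W> \<U> p" "pull_cochain \<W> n p c \<in> coboundaries \<W> n"
    using null by (auto simp: cech_null_def)
  obtain \<X> a b where X: "open_cover T \<X>" "refinement_map \<X> \<W> a" "refinement_map \<X> \<V> b"
    using open_cover_common_refinement[OF W(1) V] by blast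
  have "cech_null T n \<X> (\<lambda>s. pull_cochain \<X> n (p \<circ> a) c s - pull_cochain \<X> n (q \<circ> b) c s)"
    using indep U X(1) c refinement_map_comp X(2,3) W(2) q unfolding refinement_independent_def by blast
  then obtain \<Y> d where Y: "open_cover T \<Y>" "refinement_map \<Y> \<X> d"
    "pull_cochain \<Y> n d (\<lambda>s. pull_cochain \<X> n (p \<circ> a) c s - pull_cochain \<X> n (q \<circ> b) c s) \<in> coboundaries \<Y> n"
    by (auto simp: cech_null_def)
  have "pull_cochain \<X> n a (pull_cochain \<W> n p c) \<in> coboundaries \<X> n"
    by (rule pull_cochain_coboundaries[OF X(2) W(3)])
  then have 1: "pull_cochain \<Y> n d (pull_cochain \<X> n (p \<circ> a) c) \<in> coboundaries \<Y> n"
    using pull_cochain_coboundaries[OF Y(2)] by (simp add: pull_cochain_comp[OF X(2)])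
  have "pull_cochain \<Y> n d (pull_cochain \<X> n (q \<circ> b) c) \<in> coboundaries \<Y> n"
    using coboundaries_lincomb[OF 1 Y(3), of 1 "-1"]
      pull_cochain_lincomb[of \<Y> n d 1 "pull_cochain \<X> n (p \<circ> a) c" "-1" "pull_cochain \<X> n (q \<circ> b) c"]
    by simp
  then have "pull_cochain \<Y> n (b \<circ> d) (pull_cochain \<V> n q c) \<in> coboundaries \<Y> n"
    by (simp add: pull_cochain_comp[OF Y(2)] pull_cochain_comp[OF X(3)]
        pull_cochain_comp[OF refinement_map_comp[OF Y(2) X(3)]] comp_assoc)
  then show ?thesis
    using Y(1) refinement_map_comp[OF Y(2) X(3)] by (auto simp: cech_null_def)
qed

lemma null_lincomb:
  assumes "cech_null T n \<U> c" "cech_null T n \<U> d" "c \<in> cocycles \<U> n" "d \<in> cocycles \<U> n" "open_cover T \<U>"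
  shows "cech_null T n \<U> (\<lambda>s. a * c s + b * d s)"
proof -
  obtain \<W> p where W: "open_cover T \<W>" "refinement_map \<W> \<U> p" "pull_cochain \<W> n p c \<in> coboundaries \<W> n"
    using assms by (auto simp: cech_null_def)
  obtain \<X> q where X: "open_cover T \<X>" "refinement_map \<X> \<W> q"
    "pull_cochain \<X> n q (pull_cochain \<W> n p d) \<in> coboundaries \<X> n"
    using null_pull[OF assms(2,4,5) W(1,2)] by (auto simp: cech_null_def)
  have "pull_cochain \<X> n (p \<circ> q) (\<lambda>s. a * c s + b * d s) \<in> coboundaries \<X> n"
    using coboundaries_lincomb[OF pull_cochain_coboundaries[OF X(2) W(3)] X(3), of a b]
    by (simp add: pull_cochain_comp[OF X(2)] pull_cochain_lincomb)
  then show ?thesis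
    using X(1) refinement_map_comp[OF X(2) W(2)] by (auto simp: cech_null_def)
qed

lemma null_of_pull:
  assumes "cech_null T n \<V> (pull_cochain \<V> n q c)" "refinement_map \<V> \<U> q"
  shows "cech_null T n \<U> c"
  using assms unfolding cech_null_def by (metis pull_cochain_comp refinement_map_comp)

lemma diff_cocycles:
  assumes "y \<in> cocycles \<U> n" "z \<in> cocycles \<V> n" "refinement_map \<W> \<U> p" "refinement_map \<W> \<V> q"
  shows "(\<lambda>s. pull_cochain \<W> n p y s - pull_cochain \<W> n q z s) \<in> cocycles \<W> n"
  using cocycles_lincomb[OF pull_cochain_cocycles[OF assms(3,1)] pull_cochain_cocycles[OF assms(4,2)], of 1 "-1"]
  by simp

text \<open>The relation asks for some common refinement; here any given one can serve as the test.
  This makes symmetry, transitivity and linearity statements about null cochains on one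
  cover.\<close>

lemma rel_iff_null:
  assumes U: "open_cover T \<U>" "y \<in> cocycles \<U> n" and V: "open_cover T \<V>" "z \<in> cocycles \<V> n"
    and W: "open_cover T \<W>" "refinement_map \<W> \<U> p" "refinement_map \<W> \<V> q"
  shows "((\<U>, y), (\<V>, z)) \<in> cech_rel T n \<longleftrightarrow>
    cech_null T n \<W> (\<lambda>s. pull_cochain \<W> n p y s - pull_cochain \<W> n q z s)"
    (is "_ \<longleftrightarrow> cech_null T n \<W> ?d")
proof
  assume "cech_null T n \<W> ?d"
  then obtain \<X> a where X: "open_cover T \<X>" "refinement_map \<X> \<W> a" "pull_cochain \<X> n a ?d \<in> coboundaries \<X> n"
    by (auto simp: cech_null_def)
  have "(\<lambda>s. pull_cochain \<X> n (p \<circ> a) y s - pull_cochain \<X> n (q \<circ> a) z s) \<in> coboundaries \<X> n"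
    using X(3) pull_cochain_lincomb[of \<X> n a 1 "pull_cochain \<W> n p y" "-1" "pull_cochain \<W> n q z"]
    by (simp add: pull_cochain_comp[OF X(2)])
  then show "((\<U>, y), (\<V>, z)) \<in> cech_rel T n"
    using U V X(1) refinement_map_comp[OF X(2) W(2)] refinement_map_comp[OF X(2) W(3)]
    unfolding cech_rel_def cech_cocycles_def by blast
next
  assume "((\<U>, y), (\<V>, z)) \<in> cech_rel T n"
  then obtain \<W>' p' q' where W': "open_cover T \<W>'" "refinement_map \<W>' \<U> p'" "refinement_map \<W>' \<V> q'"
    "(\<lambda>s. pull_cochain \<W>' n p' y s - pull_cochain \<W>' n q' z s) \<in> coboundaries \<W>' n"
    unfolding cech_rel_def by blast
  obtain \<X> a b where X: "open_cover T \<X>" "refinement_map \<X> \<W>' a" "refinement_map \<X> \<W> b"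
    using open_cover_common_refinement[OF W'(1) W(1)] by blast
  \<comment> \<open>The pullback of \<open>?d\<close> to \<open>\<X>\<close> is the telescoping sum
    of \<open>?f\<close>, \<open>?e\<close> and \<open>?g\<close>. The middle term is the witness of
    the relation; each outer term compares two refinement maps into the same cover.\<close>
  let ?e = "\<lambda>s. pull_cochain \<X> n (p' \<circ> a) y s - pull_cochain \<X> n (q' \<circ> a) z s"
  let ?f = "\<lambda>s. pull_cochain \<X> n (p \<circ> b) y s - pull_cochain \<X> n (p' \<circ> a) y s"
  let ?g = "\<lambda>s. pull_cochain \<X> n (q' \<circ> a) z s - pull_cochain \<X> n (q \<circ> b) z s"
  have refs: "refinement_map \<X> \<U> (p' \<circ> a)" "refinement_map \<X> \<V> (q' \<circ> a)"
    "refinement_map \<X> \<U> (p \<circ> b)" "refinement_map \<X> \<V> (q \<circ> b)"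
    using refinement_map_comp X W W' by blast+
  have "?e \<in> coboundaries \<X> n"
    using pull_cochain_coboundaries[OF X(2) W'(4)]
      pull_cochain_lincomb[of \<X> n a 1 "pull_cochain \<W>' n p' y" "-1" "pull_cochain \<W>' n q' z"]
    by (simp add: pull_cochain_comp[OF X(2)])
  moreover have ce: "?e \<in> cocycles \<X> n" "?f \<in> cocycles \<X> n" "?g \<in> cocycles \<X> n"
    using diff_cocycles U V refs by blast+
  ultimately have "cech_null T n \<X> ?e"
    using X(1) cech_nullI unfolding cocycles_def by blast
  moreover have "cech_null T n \<X> ?f" "cech_null T n \<X> ?g"
    using indep U V X(1) refs unfolding refinement_independent_def by blast+
  ultimately have "cech_null T n \<X> (\<lambda>s. 1 * (1 * ?e s + 1 * ?f s) + 1 * ?g s)"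
    using ce X(1) by (intro null_lincomb cocycles_lincomb)
  then have "cech_null T n \<X> (pull_cochain \<X> n b ?d)"
    using pull_cochain_lincomb[of \<X> n b 1 "pull_cochain \<W> n p y" "-1" "pull_cochain \<W> n q z"]
    by (simp add: pull_cochain_comp[OF X(3)])
  then show "cech_null T n \<W> ?d"
    using null_of_pull X(3) by blast
qed

lemma rel_same_cover:
  assumes "open_cover T \<U>" "y \<in> cocycles \<U> n" "z \<in> cocycles \<U> n"
  shows "((\<U>, y), (\<U>, z)) \<in> cech_rel T n \<longleftrightarrow> cech_null T n \<U> (\<lambda>s. y s - z s)"
  using rel_iff_null[OF assms(1,2,1,3,1), of id id] assms
  by (simp add: cocycles_def pull_cochain_id)

lemma rel_pull:
  assumes "open_cover T \<U>" "y \<in> cocycles \<U> n" "open_cover T \<W>" "refinement_map \<W> \<U> p"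
  shows "((\<U>, y), (\<W>, pull_cochain \<W> n p y)) \<in> cech_rel T n"
proof -
  have c: "pull_cochain \<W> n p y \<in> cocycles \<W> n"
    using assms pull_cochain_cocycles by blast
  then have "pull_cochain \<W> n id (pull_cochain \<W> n p y) = pull_cochain \<W> n p y"
    by (intro pull_cochain_id) (simp add: cocycles_def)
  then show ?thesis
    using rel_iff_null[OF assms(1,2,3) c assms(3,4) refinement_map_id] cech_nullI[OF assms(3) zero_in_cochains zero_in_coboundaries]
    by simp
qed

lemma equiv_cech_rel: "equiv (cech_cocycles T n) (cech_rel T n)"
proof (rule equivI)
  show "cech_rel T n \<subseteq> cech_cocycles T n \<times> cech_cocycles T n"
    by (auto simp: cech_rel_def)
  show "refl_on (cech_cocycles T n) (cech_rel T n)"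
  proof (rule refl_onI)
    fix x assume "x \<in> cech_cocycles T n"
    then show "(x, x) \<in> cech_rel T n"
      by (cases x) (auto simp: cech_cocycles_def rel_same_cover cech_nullI)
  qed
  show "sym (cech_rel T n)"
  proof (rule symI)
    fix x y assume xy: "(x, y) \<in> cech_rel T n"
    obtain \<U> c \<V> d where e: "x = (\<U>, c)" "y = (\<V>, d)" by fastforce
    then have U: "open_cover T \<U>" "c \<in> cocycles \<U> n" and V: "open_cover T \<V>" "d \<in> cocycles \<V> n"
      using xy by (auto simp: cech_rel_def cech_cocycles_def)
    obtain \<W> p q where W: "open_cover T \<W>" "refinement_map \<W> \<U> p" "refinement_map \<W> \<V> q"
      using open_cover_common_refinement[OF U(1) V(1)] by blast
    let ?d = "\<lambda>s. pull_cochain \<W> n p c s - pull_cochain \<W> n q d s"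
    have "cech_null T n \<W> ?d"
      using rel_iff_null[OF U V W] xy e by blast
    then have "cech_null T n \<W> (\<lambda>s. (-1) * ?d s + 0 * ?d s)"
      using null_lincomb diff_cocycles[OF U(2) V(2) W(2,3)] W(1) by blast
    then show "(y, x) \<in> cech_rel T n"
      using rel_iff_null[OF V U W(1,3,2)] e by simp
  qed
  show "trans (cech_rel T n)"
  proof (rule transI)
    fix x y z assume xy: "(x, y) \<in> cech_rel T n" and yz: "(y, z) \<in> cech_rel T n"
    obtain \<U> c \<V> d \<U>' c' where e: "x = (\<U>, c)" "y = (\<V>, d)" "z = (\<U>', c')" by (metis surj_pair)
    then have U: "open_cover T \<U>" "c \<in> cocycles \<U> n" and V: "open_cover T \<V>" "d \<in> cocycles \<V> n"
      and U': "open_cover T \<U>'" "c' \<in> cocycles \<U>' n"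
      using xy yz by (auto simp: cech_rel_def cech_cocycles_def)
    obtain \<W> p q where W: "open_cover T \<W>" "refinement_map \<W> \<U> p" "refinement_map \<W> \<V> q"
      using open_cover_common_refinement[OF U(1) V(1)] by blast
    obtain \<X> a r where X: "open_cover T \<X>" "refinement_map \<X> \<W> a" "refinement_map \<X> \<U>' r"
      using open_cover_common_refinement[OF W(1) U'(1)] by blast
    have refs: "refinement_map \<X> \<U> (p \<circ> a)" "refinement_map \<X> \<V> (q \<circ> a)"
      using refinement_map_comp X W by blast+
    let ?d = "\<lambda>s. pull_cochain \<X> n (p \<circ> a) c s - pull_cochain \<X> n (q \<circ> a) d s"
    let ?e = "\<lambda>s. pull_cochain \<X> n (q \<circ> a) d s - pull_cochain \<X> n r c' s"
    have "cech_null T n \<X> ?d"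
      using rel_iff_null[OF U V X(1) refs] xy e by blast
    moreover have "cech_null T n \<X> ?e"
      using rel_iff_null[OF V U' X(1) refs(2) X(3)] yz e by blast
    ultimately have "cech_null T n \<X> (\<lambda>s. 1 * ?d s + 1 * ?e s)"
      using null_lincomb diff_cocycles U V U' refs X by blast
    then show "(x, z) \<in> cech_rel T n"
      using rel_iff_null[OF U U' X(1) refs(1) X(3)] e by simp
  qed
qed

abbreviation cls :: "'a set set \<Rightarrow> ('a set list \<Rightarrow> rat) \<Rightarrow> ('a set set \<times> ('a set list \<Rightarrow> rat)) set" where
  "cls \<U> c \<equiv> cech_rel T n `` {(\<U>, c)}"

lemma cls_eqI: "((\<U>, y), (\<V>, z)) \<in> cech_rel T n \<Longrightarrow> cls \<U> y = cls \<V> z"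
  using equiv_class_eq[OF equiv_cech_rel] .

lemma cls_self: "open_cover T \<U> \<Longrightarrow> y \<in> cocycles \<U> n \<Longrightarrow> (\<U>, y) \<in> cls \<U> y"
  using equiv_class_self[OF equiv_cech_rel] by (simp add: cech_cocycles_def)

lemma rel_lincomb:
  assumes 1: "((\<U>, y), (\<V>, y')) \<in> cech_rel T n" and 2: "((\<U>, z), (\<V>, z')) \<in> cech_rel T n"
  shows "((\<U>, \<lambda>s. a * y s + b * z s), (\<V>, \<lambda>s. a * y' s + b * z' s)) \<in> cech_rel T n"
proof -
  have U: "open_cover T \<U>" "y \<in> cocycles \<U> n" "z \<in> cocycles \<U> n"
    and V: "open_cover T \<V>" "y' \<in> cocycles \<V> n" "z' \<in> cocycles \<V> n"
    using 1 2 by (auto simp: cech_rel_def cech_cocycles_def)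
  obtain \<W> p q where W: "open_cover T \<W>" "refinement_map \<W> \<U> p" "refinement_map \<W> \<V> q"
    using open_cover_common_refinement[OF U(1) V(1)] by blast
  let ?d = "\<lambda>s. pull_cochain \<W> n p y s - pull_cochain \<W> n q y' s"
  let ?e = "\<lambda>s. pull_cochain \<W> n p z s - pull_cochain \<W> n q z' s"
  have "cech_null T n \<W> ?d" "cech_null T n \<W> ?e"
    using rel_iff_null[OF U(1,2) V(1,2) W] rel_iff_null[OF U(1,3) V(1,3) W] 1 2 by blast+
  then have "cech_null T n \<W> (\<lambda>s. a * ?d s + b * ?e s)"
    using null_lincomb diff_cocycles U V W by blast
  moreover have "(\<lambda>s. a * ?d s + b * ?e s) = (\<lambda>s. pull_cochain \<W> n p (\<lambda>s. a * y s + b * z s) s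
      - pull_cochain \<W> n q (\<lambda>s. a * y' s + b * z' s) s)"
    by (simp add: pull_cochain_lincomb algebra_simps)
  ultimately have "cech_null T n \<W> (\<lambda>s. pull_cochain \<W> n p (\<lambda>s. a * y s + b * z s) s
      - pull_cochain \<W> n q (\<lambda>s. a * y' s + b * z' s) s)"
    by (simp only:)
  then show ?thesis
    by (rule rel_iff_null[OF U(1) cocycles_lincomb[OF U(2,3)] V(1) cocycles_lincomb[OF V(2,3)] W, THEN iffD2])
qed

text \<open>The sum of two classes is a union over all pairs of representatives on a common cover.
  By \<open>rel_lincomb\<close> all members of this family coincide, so the union is a single
  class.\<close>

lemma cls_add:
  assumes "open_cover T \<U>" "y \<in> cocycles \<U> n" "z \<in> cocycles \<U> n"
  shows "cls \<U> y \<oplus>\<^bsub>cech_cohomology T n\<^esub> cls \<U> z = cls \<U> (\<lambda>s. y s + z s)"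
proof -
  have "cls \<V> (\<lambda>s. y' s + z' s) = cls \<U> (\<lambda>s. y s + z s)"
    if "(\<V>, y') \<in> cls \<U> y" "(\<V>, z') \<in> cls \<U> z" for \<V> y' z'
    using rel_lincomb[of \<U> y \<V> y' z z' 1 1] that cls_eqI[of \<U> _ \<V>] by fastforce
  moreover have "(\<U>, y) \<in> cls \<U> y" "(\<U>, z) \<in> cls \<U> z"
    using assms cls_self by blast+
  ultimately have "{cls \<V> (\<lambda>s. y' s + z' s) | \<V> y' z'. (\<V>, y') \<in> cls \<U> y \<and> (\<V>, z') \<in> cls \<U> z}
      = {cls \<U> (\<lambda>s. y s + z s)}"
    by blast
  then show ?thesis
    by (simp add: cech_cohomology_def)
qed

lemma cls_smult:
  assumes "open_cover T \<U>" "y \<in> cocycles \<U> n"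
  shows "r \<odot>\<^bsub>cech_cohomology T n\<^esub> cls \<U> y = cls \<U> (\<lambda>s. r * y s)"
proof -
  have "cls \<V> (\<lambda>s. r * y' s) = cls \<U> (\<lambda>s. r * y s)"
    if "(\<V>, y') \<in> cls \<U> y" for \<V> y'
    using rel_lincomb[of \<U> y \<V> y' y y' r 0] that cls_eqI[of \<U> _ \<V>] by fastforce
  moreover have "(\<U>, y) \<in> cls \<U> y"
    using assms cls_self by blast
  ultimately have "{cls \<V> (\<lambda>s. r * y' s) | \<V> y'. (\<V>, y') \<in> cls \<U> y} = {cls \<U> (\<lambda>s. r * y s)}"
    by blast
  then show ?thesis
    by (simp add: cech_cohomology_def)
qed

lemma open_cover_topspace: "open_cover T {topspace T}"
  by (simp add: open_cover_def)

lemma zero_eq_cls: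
  assumes "open_cover T \<U>"
  shows "\<zero>\<^bsub>cech_cohomology T n\<^esub> = cls \<U> (\<lambda>_. 0)"
proof -
  obtain p where p: "refinement_map \<U> {topspace T} p"
    by (rule refinement_map_ex[of \<U> "{topspace T}"]) (use assms in \<open>auto simp: open_cover_def\<close>)
  show ?thesis
    using cls_eqI[OF rel_pull[OF open_cover_topspace zero_in_cocycles assms p]]
    by (simp add: cech_cohomology_def)
qed

lemma carrier_cases:
  assumes "A \<in> carrier (cech_cohomology T n)"
  obtains \<U> y where "open_cover T \<U>" "y \<in> cocycles \<U> n" "A = cls \<U> y"
  using assms by (auto simp: cech_cohomology_def cech_cocycles_def elim!: quotientE)

lemma cls_carrier:
  "open_cover T \<U> \<Longrightarrow> y \<in> cocycles \<U> n \<Longrightarrow> cls \<U> y \<in> carrier (cech_cohomology T n)"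
  by (simp add: cech_cohomology_def cech_cocycles_def quotientI)

lemma zero_carrier: "\<zero>\<^bsub>cech_cohomology T n\<^esub> \<in> carrier (cech_cohomology T n)"
  using zero_eq_cls[OF open_cover_topspace] cls_carrier[OF open_cover_topspace zero_in_cocycles] by simp

lemma add_zero:
  assumes "A \<in> carrier (cech_cohomology T n)"
  shows "A \<oplus>\<^bsub>cech_cohomology T n\<^esub> \<zero>\<^bsub>cech_cohomology T n\<^esub> = A"
    and "\<zero>\<^bsub>cech_cohomology T n\<^esub> \<oplus>\<^bsub>cech_cohomology T n\<^esub> A = A"
  using assms by (auto elim!: carrier_cases simp: zero_eq_cls cls_add)

lemma smult_zero: "r \<odot>\<^bsub>cech_cohomology T n\<^esub> \<zero>\<^bsub>cech_cohomology T n\<^esub> = \<zero>\<^bsub>cech_cohomology T n\<^esub>"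
  by (simp add: zero_eq_cls[OF open_cover_topspace] cls_smult[OF open_cover_topspace zero_in_cocycles])

lemma carrier_trivial_if_null:
  assumes "\<And>\<U> y. open_cover T \<U> \<Longrightarrow> y \<in> cocycles \<U> n \<Longrightarrow> cech_null T n \<U> y"
  shows "carrier (cech_cohomology T n) = {\<zero>\<^bsub>cech_cohomology T n\<^esub>}"
proof -
  have "A = \<zero>\<^bsub>cech_cohomology T n\<^esub>" if A: "A \<in> carrier (cech_cohomology T n)" for A
    using A
  proof (rule carrier_cases)
    fix \<U> y assume *: "open_cover T \<U>" "y \<in> cocycles \<U> n" "A = cls \<U> y"
    have "((\<U>, y), (\<U>, \<lambda>_. 0)) \<in> cech_rel T n"
      using * assms by (simp add: rel_same_cover)
    then show ?thesis
      using cls_eqI * zero_eq_cls by metis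
  qed
  then show ?thesis using zero_carrier by blast
qed

section \<open>Linear combinations and spanning classes\<close>

abbreviation (input) "coho \<equiv> cech_cohomology T n"

lemma cls_pull:
  "open_cover T \<U> \<Longrightarrow> y \<in> cocycles \<U> n \<Longrightarrow> open_cover T \<W> \<Longrightarrow> refinement_map \<W> \<U> p
    \<Longrightarrow> cls \<U> y = cls \<W> (pull_cochain \<W> n p y)"
  using cls_eqI[OF rel_pull] .

lemma cls_lincomb:
  assumes "open_cover T \<U>" "y \<in> cocycles \<U> n" "z \<in> cocycles \<U> n"
  shows "a \<odot>\<^bsub>coho\<^esub> cls \<U> y \<oplus>\<^bsub>coho\<^esub> b \<odot>\<^bsub>coho\<^esub> cls \<U> z = cls \<U> (\<lambda>s. a * y s + b * z s)"
proof -
  have "(\<lambda>s. a * y s) \<in> cocycles \<U> n" "(\<lambda>s. b * z s) \<in> cocycles \<U> n"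
    using cocycles_lincomb[OF assms(2,2), of a 0] cocycles_lincomb[OF assms(3,3), of b 0] by simp_all
  then show ?thesis
    using assms by (simp add: cls_smult cls_add)
qed

lemma cls_eq_iff:
  assumes "open_cover T \<U>" "y \<in> cocycles \<U> n" "z \<in> cocycles \<U> n"
  shows "cls \<U> y = cls \<U> z \<longleftrightarrow> cech_null T n \<U> (\<lambda>s. y s - z s)"
  using eq_equiv_class_iff[OF equiv_cech_rel] assms
  by (simp add: rel_same_cover[symmetric] cech_cocycles_def)

text \<open>Representatives on one cover turn relations between three classes into pointwise
  relations between functions. A family over all natural numbers keeps the cocycle condition free of
  side conditions; from index 2 on it is constant.\<close>

lemma carrier_common_cover:
  assumes "A \<in> carrier coho" "B \<in> carrier coho" "C \<in> carrier coho"
  obtains \<U> y where "open_cover T \<U>" "\<And>k. y k \<in> cocycles \<U> n"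
    "A = cls \<U> (y 0)" "B = cls \<U> (y 1)" "C = cls \<U> (y (2::nat))"
proof -
  obtain \<U>0 y0 where 0: "open_cover T \<U>0" "y0 \<in> cocycles \<U>0 n" "A = cls \<U>0 y0"
    using assms(1) by (rule carrier_cases)
  obtain \<U>1 y1 where 1: "open_cover T \<U>1" "y1 \<in> cocycles \<U>1 n" "B = cls \<U>1 y1"
    using assms(2) by (rule carrier_cases)
  obtain \<U>2 y2 where 2: "open_cover T \<U>2" "y2 \<in> cocycles \<U>2 n" "C = cls \<U>2 y2"
    using assms(3) by (rule carrier_cases)
  obtain \<V> p0 p1 where V: "open_cover T \<V>" "refinement_map \<V> \<U>0 p0" "refinement_map \<V> \<U>1 p1"
    using open_cover_common_refinement[OF 0(1) 1(1)] by blast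
  obtain \<W> q p2 where W: "open_cover T \<W>" "refinement_map \<W> \<V> q" "refinement_map \<W> \<U>2 p2"
    using open_cover_common_refinement[OF V(1) 2(1)] by blast
  have refs: "refinement_map \<W> \<U>0 (p0 \<circ> q)" "refinement_map \<W> \<U>1 (p1 \<circ> q)"
    using refinement_map_comp W(2) V(2,3) by blast+
  define y :: "nat \<Rightarrow> 'a set list \<Rightarrow> rat" where
    "y k = (if k = 0 then pull_cochain \<W> n (p0 \<circ> q) y0 else if k = 1 then pull_cochain \<W> n (p1 \<circ> q) y1
      else pull_cochain \<W> n p2 y2)" for k
  have "y k \<in> cocycles \<W> n" for k
    unfolding y_def by (simp add: pull_cochain_cocycles[OF refs(1) 0(2)]
        pull_cochain_cocycles[OF refs(2) 1(2)] pull_cochain_cocycles[OF W(3) 2(2)])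
  moreover have "A = cls \<W> (y 0)" "B = cls \<W> (y 1)" "C = cls \<W> (y 2)"
    using cls_pull[OF 0(1,2) W(1) refs(1)] cls_pull[OF 1(1,2) W(1) refs(2)]
      cls_pull[OF 2(1,2) W(1,3)] 0(3) 1(3) 2(3) by (simp_all add: y_def)
  ultimately show thesis using that W(1) by blast
qed

lemma lincomb_carrier:
  assumes "A \<in> carrier coho" "B \<in> carrier coho"
  shows "a \<odot>\<^bsub>coho\<^esub> A \<oplus>\<^bsub>coho\<^esub> b \<odot>\<^bsub>coho\<^esub> B \<in> carrier coho"
proof -
  obtain \<U> y where U: "open_cover T \<U>" "\<And>k. y k \<in> cocycles \<U> n" "A = cls \<U> (y 0)" "B = cls \<U> (y (1::nat))"
    using carrier_common_cover[OF assms assms(2)] by metis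
  show ?thesis
    unfolding U(3,4) cls_lincomb[OF U(1,2,2)] by (intro cls_carrier U(1) cocycles_lincomb U(2))
qed

lemma smult_carrier_0:
  assumes "A \<in> carrier coho"
  shows "0 \<odot>\<^bsub>coho\<^esub> A = \<zero>\<^bsub>coho\<^esub>"
  using assms by (auto elim!: carrier_cases simp: cls_smult zero_eq_cls)

lemma smult_carrier:
  assumes "A \<in> carrier coho"
  shows "a \<odot>\<^bsub>coho\<^esub> A \<in> carrier coho"
  using assms
proof (rule carrier_cases)
  fix \<U> y assume *: "open_cover T \<U>" "y \<in> cocycles \<U> n" "A = cls \<U> y"
  then show ?thesis
    using cocycles_lincomb[OF *(2,2), of a 0] by (simp add: cls_smult cls_carrier)
qed

text \<open>The division by \<open>c\<close> takes place on cocycles over one cover, where linear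
  combinations are pointwise, and only the outcome is carried back to classes.\<close>

lemma solve_for_third:
  assumes carr: "A \<in> carrier coho" "B \<in> carrier coho" "C \<in> carrier coho"
    and eq: "(a \<odot>\<^bsub>coho\<^esub> A \<oplus>\<^bsub>coho\<^esub> b \<odot>\<^bsub>coho\<^esub> B) \<oplus>\<^bsub>coho\<^esub> c \<odot>\<^bsub>coho\<^esub> C = \<zero>\<^bsub>coho\<^esub>" and c: "c \<noteq> 0"
  shows "C = (- a / c) \<odot>\<^bsub>coho\<^esub> A \<oplus>\<^bsub>coho\<^esub> (- b / c) \<odot>\<^bsub>coho\<^esub> B"
proof -
  obtain \<U> y where U: "open_cover T \<U>" "\<And>k. y k \<in> cocycles \<U> n" "A = cls \<U> (y 0)" "B = cls \<U> (y 1)"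
    "C = cls \<U> (y (2::nat))"
    using carrier_common_cover[OF carr] by metis
  let ?d = "\<lambda>s. a * y 0 s + b * y 1 s + c * y 2 s"
  have 1: "(\<lambda>s. a * y 0 s + b * y 1 s) \<in> cocycles \<U> n" "(\<lambda>s. c * y 2 s) \<in> cocycles \<U> n"
    using cocycles_lincomb[OF U(2,2), of a 0 b 1] cocycles_lincomb[OF U(2,2), of c 2 0 2] by simp_all
  then have d: "?d \<in> cocycles \<U> n"
    using cocycles_lincomb[OF 1, of 1 1] by simp
  have "cls \<U> ?d = cls \<U> (\<lambda>s. a * y 0 s + b * y 1 s) \<oplus>\<^bsub>coho\<^esub> cls \<U> (\<lambda>s. c * y 2 s)"
    by (rule cls_add[OF U(1) 1, symmetric])
  also have "\<dots> = \<zero>\<^bsub>coho\<^esub>"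
    using eq unfolding U(3-5) cls_lincomb[OF U(1,2,2)] unfolding cls_smult[OF U(1,2)] .
  also have "\<dots> = cls \<U> (\<lambda>_. 0)"
    by (rule zero_eq_cls[OF U(1)])
  finally have null: "cech_null T n \<U> ?d"
    using cls_eq_iff[OF U(1) d zero_in_cocycles] by simp
  have "cech_null T n \<U> (\<lambda>s. (1 / c) * ?d s + 0 * ?d s)"
    by (rule null_lincomb[OF null null d d U(1)])
  moreover have "(\<lambda>s. (1 / c) * ?d s + 0 * ?d s) = (\<lambda>s. y 2 s - ((- a / c) * y 0 s + (- b / c) * y 1 s))"
    using c by (simp add: field_simps)
  ultimately have "cech_null T n \<U> (\<lambda>s. y 2 s - ((- a / c) * y 0 s + (- b / c) * y 1 s))"
    by (simp only:)
  then have "cls \<U> (y 2) = cls \<U> (\<lambda>s. (- a / c) * y 0 s + (- b / c) * y 1 s)"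
    by (rule cls_eq_iff[OF U(1,2) cocycles_lincomb[OF U(2,2)], THEN iffD2])
  then show ?thesis
    unfolding U(3-5) cls_lincomb[OF U(1,2,2)] .
qed

text \<open>A maximal independent family has at most two members. It is an independent pair if there
  is one, else a single independent class padded with zero, else zero twice. In each case a relation
  with a further class \<open>C\<close> must involve \<open>C\<close>, since otherwise the family
  itself would be dependent; so \<open>C\<close> can be solved for.\<close>

lemma spanned_by_two:
  assumes dep: "\<And>A B C. A \<in> carrier coho \<Longrightarrow> B \<in> carrier coho \<Longrightarrow> C \<in> carrier coho \<Longrightarrow>
    \<exists>a b c. (a \<noteq> 0 \<or> b \<noteq> 0 \<or> c \<noteq> 0) \<and> (a \<odot>\<^bsub>coho\<^esub> A \<oplus>\<^bsub>coho\<^esub> b \<odot>\<^bsub>coho\<^esub> B) \<oplus>\<^bsub>coho\<^esub> c \<odot>\<^bsub>coho\<^esub> C = \<zero>\<^bsub>coho\<^esub>"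
  shows "\<exists>A\<in>carrier coho. \<exists>B\<in>carrier coho. \<forall>C\<in>carrier coho. \<exists>a b. C = a \<odot>\<^bsub>coho\<^esub> A \<oplus>\<^bsub>coho\<^esub> b \<odot>\<^bsub>coho\<^esub> B"
proof -
  let ?O = "\<zero>\<^bsub>coho\<^esub>"
  have O: "?O \<in> carrier coho" by (rule zero_carrier)
  have "\<exists>A\<in>carrier coho. \<exists>B\<in>carrier coho. \<forall>C\<in>carrier coho. \<exists>a b c. c \<noteq> 0 \<and>
      (a \<odot>\<^bsub>coho\<^esub> A \<oplus>\<^bsub>coho\<^esub> b \<odot>\<^bsub>coho\<^esub> B) \<oplus>\<^bsub>coho\<^esub> c \<odot>\<^bsub>coho\<^esub> C = ?O"
  proof (cases "\<exists>A\<in>carrier coho. \<exists>B\<in>carrier coho. \<forall>a b. a \<odot>\<^bsub>coho\<^esub> A \<oplus>\<^bsub>coho\<^esub> b \<odot>\<^bsub>coho\<^esub> B = ?O \<longrightarrow> a = 0 \<and> b = 0")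
    case True
    then obtain A B where AB: "A \<in> carrier coho" "B \<in> carrier coho"
      "\<And>a b. a \<odot>\<^bsub>coho\<^esub> A \<oplus>\<^bsub>coho\<^esub> b \<odot>\<^bsub>coho\<^esub> B = ?O \<Longrightarrow> a = 0 \<and> b = 0"
      by blast
    have "\<exists>a b c. c \<noteq> 0 \<and> (a \<odot>\<^bsub>coho\<^esub> A \<oplus>\<^bsub>coho\<^esub> b \<odot>\<^bsub>coho\<^esub> B) \<oplus>\<^bsub>coho\<^esub> c \<odot>\<^bsub>coho\<^esub> C = ?O"
      if C: "C \<in> carrier coho" for C
    proof -
      obtain a b c where abc: "a \<noteq> 0 \<or> b \<noteq> 0 \<or> c \<noteq> 0"
        "(a \<odot>\<^bsub>coho\<^esub> A \<oplus>\<^bsub>coho\<^esub> b \<odot>\<^bsub>coho\<^esub> B) \<oplus>\<^bsub>coho\<^esub> c \<odot>\<^bsub>coho\<^esub> C = ?O"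
        using dep[OF AB(1,2) C] by blast
      have "c \<noteq> 0"
      proof
        assume "c = 0"
        then have "a \<odot>\<^bsub>coho\<^esub> A \<oplus>\<^bsub>coho\<^esub> b \<odot>\<^bsub>coho\<^esub> B = ?O"
          using abc(2) lincomb_carrier[OF AB(1,2)] by (simp add: smult_carrier_0[OF C] add_zero)
        then show False using AB(3) abc(1) \<open>c = 0\<close> by blast
      qed
      then show ?thesis using abc(2) by blast
    qed
    then show ?thesis using AB(1,2) by blast
  next
    case False
    have pair: "\<exists>a b. (a \<noteq> 0 \<or> b \<noteq> 0) \<and> a \<odot>\<^bsub>coho\<^esub> A \<oplus>\<^bsub>coho\<^esub> b \<odot>\<^bsub>coho\<^esub> B = ?O"
      if "A \<in> carrier coho" "B \<in> carrier coho" for A B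
      using False that by blast
    show ?thesis
    proof (cases "\<exists>A\<in>carrier coho. \<forall>a. a \<odot>\<^bsub>coho\<^esub> A = ?O \<longrightarrow> a = 0")
      case True
      then obtain A where A: "A \<in> carrier coho" "\<And>a. a \<odot>\<^bsub>coho\<^esub> A = ?O \<Longrightarrow> a = 0"
        by blast
      have "\<exists>a b c. c \<noteq> 0 \<and> (a \<odot>\<^bsub>coho\<^esub> A \<oplus>\<^bsub>coho\<^esub> b \<odot>\<^bsub>coho\<^esub> ?O) \<oplus>\<^bsub>coho\<^esub> c \<odot>\<^bsub>coho\<^esub> C = ?O"
        if C: "C \<in> carrier coho" for C
      proof -
        obtain a c where ac: "a \<noteq> 0 \<or> c \<noteq> 0" "a \<odot>\<^bsub>coho\<^esub> A \<oplus>\<^bsub>coho\<^esub> c \<odot>\<^bsub>coho\<^esub> C = ?O"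
          using pair[OF A(1) C] by blast
        have "c \<noteq> 0"
        proof
          assume "c = 0"
          then have "a \<odot>\<^bsub>coho\<^esub> A = ?O"
            using ac(2) smult_carrier[OF A(1)] by (simp add: smult_carrier_0[OF C] add_zero)
          then show False using A(2) ac(1) \<open>c = 0\<close> by blast
        qed
        moreover have "(a \<odot>\<^bsub>coho\<^esub> A \<oplus>\<^bsub>coho\<^esub> 0 \<odot>\<^bsub>coho\<^esub> ?O) \<oplus>\<^bsub>coho\<^esub> c \<odot>\<^bsub>coho\<^esub> C = ?O"
          using ac(2) by (simp add: smult_zero add_zero smult_carrier[OF A(1)])
        ultimately show ?thesis by blast
      qed
      then show ?thesis using A(1) O by blast
    next
      case False
      have "\<exists>a b c. c \<noteq> 0 \<and> (a \<odot>\<^bsub>coho\<^esub> ?O \<oplus>\<^bsub>coho\<^esub> b \<odot>\<^bsub>coho\<^esub> ?O) \<oplus>\<^bsub>coho\<^esub> c \<odot>\<^bsub>coho\<^esub> C = ?O"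
        if C: "C \<in> carrier coho" for C
      proof -
        obtain c where "c \<noteq> 0" "c \<odot>\<^bsub>coho\<^esub> C = ?O"
          using False C by blast
        then show ?thesis
          using O by (intro exI[of _ 0] exI[of _ c]) (simp add: smult_zero add_zero)
      qed
      then show ?thesis using O by blast
    qed
  qed
  then obtain A B where AB: "A \<in> carrier coho" "B \<in> carrier coho"
    and *: "\<forall>C\<in>carrier coho. \<exists>a b c. c \<noteq> 0 \<and>
      (a \<odot>\<^bsub>coho\<^esub> A \<oplus>\<^bsub>coho\<^esub> b \<odot>\<^bsub>coho\<^esub> B) \<oplus>\<^bsub>coho\<^esub> c \<odot>\<^bsub>coho\<^esub> C = ?O"
    by (elim bexE) (rule that)
  have "\<exists>a b. C = a \<odot>\<^bsub>coho\<^esub> A \<oplus>\<^bsub>coho\<^esub> b \<odot>\<^bsub>coho\<^esub> B" if C: "C \<in> carrier coho" for C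
  proof -
    obtain a b c where "c \<noteq> 0" "(a \<odot>\<^bsub>coho\<^esub> A \<oplus>\<^bsub>coho\<^esub> b \<odot>\<^bsub>coho\<^esub> B) \<oplus>\<^bsub>coho\<^esub> c \<odot>\<^bsub>coho\<^esub> C = ?O"
      using bspec[OF * C] by (elim exE conjE) (rule that)
    from solve_for_third[OF AB C this(2,1)] show ?thesis by blast
  qed
  then show ?thesis using AB by (intro bexI ballI)
qed

end


section \<open>Local functions along the word\<close>

definition agree :: "nat \<Rightarrow> (int \<Rightarrow> 'a) \<Rightarrow> (int \<Rightarrow> 'a) \<Rightarrow> bool" where
  "agree R x y \<longleftrightarrow> (\<forall>i. \<bar>i\<bar> \<le> int R \<longrightarrow> x i = y i)"

definition translate :: "int \<Rightarrow> (int \<Rightarrow> 'a) \<Rightarrow> int \<Rightarrow> 'a" where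
  "translate n x = (\<lambda>i. x (i + n))"

text \<open>Such a function is the restriction to the orbit of \<open>w\<close> of a locally
  constant function on \<open>Theta w\<close>, the orbit being parametrised by the amount of
  translation.\<close>

definition local_function :: "(int \<Rightarrow> 'a) \<Rightarrow> nat \<Rightarrow> (int \<Rightarrow> 'b) \<Rightarrow> bool" where
  "local_function w R \<phi> \<longleftrightarrow> (\<forall>n n'. agree R (translate n w) (translate n' w) \<longrightarrow> \<phi> n = \<phi> n')"

text \<open>Recurrence of the windows around the origin suffices, since every finite factor of
  \<open>w\<close> lies in such a window.\<close>

definition uniformly_recurrent :: "(int \<Rightarrow> 'a) \<Rightarrow> bool" where
  "uniformly_recurrent w \<longleftrightarrow>
     (\<forall>N. \<exists>L::nat. \<forall>n. \<exists>d. \<bar>d - n\<bar> \<le> int L \<and> agree N (translate d w) w)"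

text \<open>A block of length \<open>L\<close> together with \<open>R\<close> letters of context on
  each side. The template \<open>x\<close> is indexed relative to the start of the block, hence the
  negative arguments.\<close>

definition occurs_at :: "(int \<Rightarrow> 'a) \<Rightarrow> nat \<Rightarrow> nat \<Rightarrow> (int \<Rightarrow> 'a) \<Rightarrow> int \<Rightarrow> bool" where
  "occurs_at w R L x q \<longleftrightarrow> (\<forall>r. - int R \<le> r \<and> r < int (L + R) \<longrightarrow> w (q + r) = x r)"

text \<open>Each finite stretch gets a tiling of its own; tilings of different stretches need not be
  compatible. What is uniform is the length \<open>L\<close> and the pair of templates, which depend
  on \<open>R\<close> alone.\<close>

definition two_block :: "(int \<Rightarrow> 'a) \<Rightarrow> bool" where
  "two_block w \<longleftrightarrow> (\<forall>R. \<exists>L>0. \<exists>x y. \<forall>a b. a \<le> b \<longrightarrow>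
     (\<exists>q. \<exists>t::nat. q \<le> a \<and> b < q + int t * int L \<and>
        (\<forall>i<t. occurs_at w R L x (q + int i * int L) \<or> occurs_at w R L y (q + int i * int L))))"

lemma agree_refl [simp]: "agree R x x"
  by (simp add: agree_def)

lemma agree_mono: "agree N x y \<Longrightarrow> R \<le> N \<Longrightarrow> agree R x y"
  unfolding agree_def by fastforce

lemma agree_sym: "agree N x y \<longleftrightarrow> agree N y x"
  by (auto simp: agree_def)

lemma agree_trans: "agree N x y \<Longrightarrow> agree N y z \<Longrightarrow> agree N x z"
  by (auto simp: agree_def)

lemma agree_translate:
  assumes "agree N x y" "\<bar>k\<bar> + int R \<le> int N"
  shows "agree R (translate k x) (translate k y)"
  unfolding agree_def translate_def
proof (intro allI impI)
  fix i assume "\<bar>i\<bar> \<le> int R"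
  then have "\<bar>i + k\<bar> \<le> int N" using assms(2) by linarith
  then show "x (i + k) = y (i + k)" using assms(1) by (simp add: agree_def)
qed

lemma translate_0 [simp]: "translate 0 x = x"
  by (simp add: translate_def)

lemma translate_translate [simp]: "translate a (translate b x) = translate (a + b) x"
  by (simp add: translate_def algebra_simps)

lemma local_functionD:
  "local_function w R \<phi> \<Longrightarrow> agree R (translate n w) (translate n' w) \<Longrightarrow> \<phi> n = \<phi> n'"
  by (simp add: local_function_def)

text \<open>Two letters admit only finitely many windows of a given radius, and \<phi> factors
  through the window.\<close>

lemma finite_range_local_function:
  fixes w :: "int \<Rightarrow> letter"
  assumes "local_function w R \<phi>"
  shows "finite (range \<phi>)"
proof -
  define win where "win n = map (\<lambda>i. w (i + n)) [- int R..int R]" for n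
  have UNIV: "UNIV = {La, Lb}"
    using letter.exhaust by auto
  have "range win \<subseteq> {xs. set xs \<subseteq> UNIV \<and> length xs = length [- int R..int R]}"
    by (auto simp: win_def)
  then have fin: "finite (range win)"
    by (rule finite_subset) (intro finite_lists_length_eq, simp add: UNIV)
  have "agree R (translate n w) (translate n' w)" if "win n = win n'" for n n'
    using that by (auto simp: win_def agree_def translate_def abs_le_iff)
  then have "\<phi> n = \<phi> n'" if "win n = win n'" for n n'
    using assms that local_functionD by blast
  moreover have "win (inv_into UNIV win (win n)) = win n" for n
    by (simp add: f_inv_into_f)
  ultimately have "\<phi> n = (\<phi> \<circ> inv_into UNIV win) (win n)" for n
    unfolding comp_apply by (metis (no_types))
  then have "range \<phi> \<subseteq> (\<phi> \<circ> inv_into UNIV win) ` range win"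
    by blast
  then show ?thesis
    using fin finite_surj by blast
qed

section \<open>Discrete primitives of local functions\<close>

definition int_sum :: "(int \<Rightarrow> rat) \<Rightarrow> int \<Rightarrow> rat" where
  "int_sum \<phi> n = (\<Sum>l\<in>{0..<n}. \<phi> l) - (\<Sum>l\<in>{n..<0}. \<phi> l)"

lemma int_sum_step: "int_sum \<phi> (n + 1) - int_sum \<phi> n = \<phi> n"
proof (cases "n \<ge> 0")
  case True
  then have "{0..<n+1} = insert n {0..<n}" by auto
  then show ?thesis using True by (simp add: int_sum_def)
next
  case False
  then have "{n..<0} = insert n {n+1..<0}" by auto
  then show ?thesis using False by (simp add: int_sum_def)
qed

lemma increment_eq:
  fixes H :: "int \<Rightarrow> rat"
  assumes step: "\<And>n. H (n + 1) - H n = \<phi> n"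
    and eq: "\<And>l. \<bar>l\<bar> \<le> N \<Longrightarrow> \<phi> (d + l) = \<phi> (e + l)"
    and ab: "\<bar>a\<bar> \<le> N" "\<bar>b\<bar> \<le> N"
  shows "H (d + b) - H (d + a) = H (e + b) - H (e + a)"
proof -
  have *: "H (d + b) - H (d + a) = H (e + b) - H (e + a)"
    if "a \<le> b" "\<bar>a\<bar> \<le> N" "\<bar>b\<bar> \<le> N" for a b
    using that
  proof (induction b rule: int_ge_induct)
    case base
    then show ?case by simp
  next
    case (step i)
    then have i: "\<bar>i\<bar> \<le> N" by linarith
    show ?case
      using step.IH step.prems i eq[OF i] assms(1)[of "d + i"] assms(1)[of "e + i"]
      by (simp add: add.assoc)
  qed
  show ?thesis
  proof (cases "a \<le> b")
    case False
    then show ?thesis using *[of b a] ab by simp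
  qed (use * ab in blast)
qed

lemma int_div_less:
  fixes k L t :: int
  assumes "k < t * L" "0 < L"
  shows "k div L < t"
proof (rule ccontr)
  assume "\<not> k div L < t"
  then have "t * L \<le> k div L * L"
    using assms(2) by (intro mult_right_mono) auto
  also have "\<dots> \<le> k"
    using assms(2) pos_mod_sign[of L k] div_mult_mod_eq[of k L] by linarith
  finally show False using assms(1) by simp
qed

text \<open>The argument of Gottschalk and Hedlund: between a maximum and a minimum of \<open>H\<close> the
  increment is the largest possible one, so at every recurrence of a window containing both the
  maximum is attained again, and \<open>H\<close> is read off from the distance to such a place.\<close>

lemma local_function_if_finite_range:
  fixes H :: "int \<Rightarrow> rat"
  assumes rec: "uniformly_recurrent w" and loc: "local_function w R \<phi>"
    and step: "\<And>n. H (n + 1) - H n = \<phi> n" and fin: "finite (range H)"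
  shows "\<exists>M. local_function w M H"
proof -
  obtain n1 where n1: "H n1 = Max (range H)"
    using Max_in[OF fin] by auto
  obtain n0 where n0: "H n0 = Min (range H)"
    using Min_in[OF fin] by auto
  have max: "H n \<le> H n1" and min: "H n0 \<le> H n" for n
    using fin n0 n1 by auto
  define B where "B = nat (max \<bar>n0\<bar> \<bar>n1\<bar>)"
  have B: "\<bar>n0\<bar> \<le> int B" "\<bar>n1\<bar> \<le> int B" by (auto simp: B_def)
  define N where "N = B + R"
  obtain L :: nat where L: "\<And>n. \<exists>d. \<bar>d - n\<bar> \<le> int L \<and> agree N (translate d w) w"
    using rec unfolding uniformly_recurrent_def by metis
  have attained: "H (d + n1) = H n1" if "agree N (translate d w) w" for d
  proof -
    have "\<phi> (d + l) = \<phi> (0 + l)" if l: "\<bar>l\<bar> \<le> int B" for l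
    proof (rule local_functionD[OF loc])
      have "agree R (translate l (translate d w)) (translate l w)"
        by (rule agree_translate[OF \<open>agree N _ _\<close>]) (use l N_def in simp)
      then show "agree R (translate (d + l) w) (translate (0 + l) w)"
        by (simp add: add.commute)
    qed
    then have "H (d + n1) - H (d + n0) = H (0 + n1) - H (0 + n0)"
      by (rule increment_eq[where H = H and \<phi> = \<phi>, OF step]) (auto simp: B_def)
    then show ?thesis
      using max[of "d + n1"] min[of "d + n0"] by simp
  qed
  \<comment> \<open>A recurrence at distance at most \<open>L\<close> from \<open>n\<close> is
    visible in the window around \<open>n\<close>, hence is repeated at the same offset from
    \<open>n'\<close>. There \<open>H\<close> attains its maximum in both cases, and the increments
    of \<open>H\<close> from \<open>n\<close> and from \<open>n'\<close> to these places agree; so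
    do the values at the start.\<close>
  have "local_function w (L + N + N) H"
    unfolding local_function_def
  proof (intro allI impI)
    fix n n' assume agr: "agree (L + N + N) (translate n w) (translate n' w)"
    obtain d where d: "\<bar>d - n\<bar> \<le> int L" "agree N (translate d w) w"
      using L by blast
    have "agree N (translate (d - n) (translate n w)) (translate (d - n) (translate n' w))"
      by (rule agree_translate[OF agr]) (use d in simp)
    then have "agree N (translate (d - n + n') w) w"
      using agree_trans[OF _ d(2), of "translate (d - n + n') w"] by (simp add: agree_sym)
    then have 1: "H (d - n + n' + n1) = H (d + n1)"
      using attained d(2) by metis
    have "\<phi> (n + l) = \<phi> (n' + l)" if l: "\<bar>l\<bar> \<le> int (L + B)" for l
    proof (rule local_functionD[OF loc])
      have "agree R (translate l (translate n w)) (translate l (translate n' w))"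
        by (rule agree_translate[OF agr]) (use l N_def in simp)
      then show "agree R (translate (n + l) w) (translate (n' + l) w)"
        by (simp add: add.commute)
    qed
    moreover have "\<bar>d - n + n1\<bar> \<le> int (L + B)"
      using d(1) B(2) by linarith
    ultimately have "H (n + (d - n + n1)) - H (n + 0) = H (n' + (d - n + n1)) - H (n' + 0)"
      by (intro increment_eq[where H = H and \<phi> = \<phi> and N = "int (L + B)", OF step]) simp_all
    then show "H n = H n'"
      using 1 by (simp add: algebra_simps)
  qed
  then show ?thesis by blast
qed

text \<open>Within one tiling \<open>H\<close> returns to the value \<open>H q\<close> at every
  block boundary, and inside a block it differs from that value by \<open>D r\<close> with
  \<open>r < L\<close>. Each \<open>D r\<close> is a local function and so takes finitely many
  values. The tiling, and with it \<open>q\<close>, depends on \<open>n\<close>; a stretch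
  containing both 0 and \<open>n\<close> lets \<open>H q\<close> be eliminated in favour of
  \<open>H 0\<close>.\<close>

lemma finite_range_if_block_sums_0:
  fixes w :: "int \<Rightarrow> letter" and H :: "int \<Rightarrow> rat"
  assumes loc: "local_function w R \<phi>" and step: "\<And>n. H (n + 1) - H n = \<phi> n" and L: "L > 0"
    and blocks: "\<And>a b. a \<le> b \<Longrightarrow> \<exists>q. \<exists>t::nat. q \<le> a \<and> b < q + int t * int L \<and>
      (\<forall>i<t. H (q + int i * int L + int L) = H (q + int i * int L))"
  shows "finite (range H)"
proof -
  define D where "D r n = H n - H (n - int r)" for r n
  have "local_function w (r + R) (D r)" for r
    unfolding local_function_def
  proof (intro allI impI)
    fix n n' assume agr: "agree (r + R) (translate n w) (translate n' w)"
    have "\<phi> (n + l) = \<phi> (n' + l)" if l: "\<bar>l\<bar> \<le> int r" for l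
    proof (rule local_functionD[OF loc])
      have "agree R (translate l (translate n w)) (translate l (translate n' w))"
        by (rule agree_translate[OF agr]) (use l in simp)
      then show "agree R (translate (n + l) w) (translate (n' + l) w)"
        by (simp add: add.commute)
    qed
    then have "H (n + 0) - H (n + (- int r)) = H (n' + 0) - H (n' + (- int r))"
      by (rule increment_eq[where H = H and \<phi> = \<phi>, OF step]) auto
    then show "D r n = D r n'" by (simp add: D_def)
  qed
  then have fin: "finite (range (D r))" for r
    using finite_range_local_function by blast
  have "H n \<in> (\<Union>r0<L. \<Union>r1<L. (\<lambda>x. H 0 + x - D r0 0) ` range (D r1))" for n
  proof -
    have "min 0 n \<le> max 0 n" by simp
    from blocks[OF this] obtain q t where q: "q \<le> min 0 n" "max 0 n < q + int t * int L"
      "\<And>i. i < t \<Longrightarrow> H (q + int i * int L + int L) = H (q + int i * int L)"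
      by blast
    have Hq: "H (q + int i * int L) = H q" if "i \<le> t" for i
      using that
    proof (induction i)
      case (Suc i)
      have "q + int (Suc i) * int L = q + int i * int L + int L"
        by (simp add: algebra_simps)
      then show ?case using Suc q(3)[of i] by (simp add: add.assoc)
    qed simp
    have pos: "\<exists>r<L. D r k = H k - H q" if k: "q \<le> k" "k < q + int t * int L" for k
    proof -
      define i r where "i = nat ((k - q) div int L)" and "r = nat ((k - q) mod int L)"
      have "k - q < int t * int L" using k by linarith
      then have "(k - q) div int L < int t"
        using L by (simp add: int_div_less)
      moreover have "0 \<le> (k - q) div int L"
        using k L by (simp add: pos_imp_zdiv_nonneg_iff)
      moreover have "0 \<le> (k - q) mod int L" "(k - q) mod int L < int L"
        using L by auto
      moreover have "k - q = (k - q) div int L * int L + (k - q) mod int L"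
        by simp
      ultimately have ir: "i < t" "r < L" "int i = (k - q) div int L" "int r = (k - q) mod int L"
        unfolding i_def r_def by (simp_all add: nat_less_iff)
      have "int i * int L + int r = k - q"
        unfolding ir by simp
      then have "k - int r = q + int i * int L"
        by simp
      then show ?thesis
        using Hq[of i] ir unfolding D_def by auto
    qed
    obtain r0 where "r0 < L" "D r0 0 = H 0 - H q"
      using pos[of 0] q by auto
    moreover obtain r1 where "r1 < L" "D r1 n = H n - H q"
      using pos[of n] q by auto
    ultimately have "H n = H 0 + D r1 n - D r0 0" "r0 < L" "r1 < L"
      by simp_all
    then show ?thesis by blast
  qed
  then have "range H \<subseteq> (\<Union>r0<L. \<Union>r1<L. (\<lambda>x. H 0 + x - D r0 0) ` range (D r1))"
    by blast
  moreover have "finite (\<Union>r0<L. \<Union>r1<L. (\<lambda>x. H 0 + x - D r0 0) ` range (D r1))"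
    using fin by blast
  ultimately show ?thesis
    using finite_subset by blast
qed

text \<open>The cross product of the two rows is a solution. If it vanishes, the rows are dependent
  and a row with nonzero first entry yields a solution with third coordinate 0; if both first
  entries vanish, the first unit vector solves the system.\<close>

lemma two_equations_three_unknowns:
  fixes s t :: "nat \<Rightarrow> rat"
  shows "\<exists>a b c. (a \<noteq> 0 \<or> b \<noteq> 0 \<or> c \<noteq> 0) \<and> a * s 0 + b * s 1 + c * s 2 = 0 \<and> a * t 0 + b * t 1 + c * t 2 = 0"
proof (cases "s 1 * t 2 - s 2 * t 1 \<noteq> 0 \<or> s 2 * t 0 - s 0 * t 2 \<noteq> 0 \<or> s 0 * t 1 - s 1 * t 0 \<noteq> 0")
  case True
  then show ?thesis
    by (intro exI[of _ "s 1 * t 2 - s 2 * t 1"] exI[of _ "s 2 * t 0 - s 0 * t 2"]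
        exI[of _ "s 0 * t 1 - s 1 * t 0"]) (simp add: algebra_simps)
next
  case False
  then have z: "s 1 * t 2 = s 2 * t 1" "s 2 * t 0 = s 0 * t 2" "s 0 * t 1 = s 1 * t 0"
    by auto
  consider "s 0 = 0" "t 0 = 0" | "s 0 \<noteq> 0" | "t 0 \<noteq> 0"
    by blast
  then show ?thesis
  proof cases
    case 1
    then show ?thesis by (intro exI[of _ 1] exI[of _ 0]) auto
  next
    case 2
    then show ?thesis
      using z by (intro exI[of _ "s 1"] exI[of _ "- s 0"] exI[of _ 0]) (auto simp: algebra_simps)
  next
    case 3
    then show ?thesis
      using z by (intro exI[of _ "t 1"] exI[of _ "- t 0"] exI[of _ 0]) (auto simp: algebra_simps)
  qed
qed

lemma three_local_functions_dependent:
  fixes w :: "int \<Rightarrow> letter" and \<phi> :: "nat \<Rightarrow> int \<Rightarrow> rat"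
  assumes rec: "uniformly_recurrent w" and two: "two_block w" and loc: "\<And>k. local_function w R (\<phi> k)"
  shows "\<exists>a b c. (a \<noteq> 0 \<or> b \<noteq> 0 \<or> c \<noteq> 0) \<and>
    (\<exists>\<psi> M. local_function w M \<psi> \<and> (\<forall>n. \<psi> (n + 1) - \<psi> n = a * \<phi> 0 n + b * \<phi> 1 n + c * \<phi> 2 n))"
proof -
  obtain L :: nat and bl bl' where L: "L > 0" and blocks: "\<forall>a b. a \<le> b \<longrightarrow>
     (\<exists>q. \<exists>t::nat. q \<le> a \<and> b < q + int t * int L \<and>
        (\<forall>i<t. occurs_at w R L bl (q + int i * int L) \<or> occurs_at w R L bl' (q + int i * int L)))"
    using two[unfolded two_block_def, THEN spec[of _ R]] by (elim exE conjE) (rule that)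
  define matches where "matches = occurs_at w R L"
  \<comment> \<open>The sum of \<open>\<phi> k\<close> over a block of type \<open>Z\<close>,
    computed at one chosen occurrence. If \<open>Z\<close> never occurs the value is arbitrary,
    which does no harm: it only adds an equation that is never applied.\<close>
  define S where "S Z k = int_sum (\<phi> k) ((SOME q. matches Z q) + int L) - int_sum (\<phi> k) (SOME q. matches Z q)" for Z k
  have S: "int_sum (\<phi> k) (q + int L) - int_sum (\<phi> k) q = S Z k" if "matches Z q" for Z q k
  proof -
    define q' where "q' = (SOME q. matches Z q)"
    have q': "matches Z q'"
      unfolding q'_def by (rule someI[of "matches Z", OF that])
    have agr: "\<phi> k (q + int i) = \<phi> k (q' + int i)" if "i < L" for i
    proof (rule local_functionD[OF loc])
      show "agree R (translate (q + int i) w) (translate (q' + int i) w)"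
        unfolding agree_def translate_def
      proof (intro allI impI)
        fix j assume j: "\<bar>j\<bar> \<le> int R"
        \<comment> \<open>A window of radius \<open>R\<close> around a position of the block stays
          inside the block and its context, so both occurrences show the same letters.\<close>
        then have "- int R \<le> int i + j" "int i + j < int (L + R)"
          using \<open>i < L\<close> by linarith+
        then have "w (q + (int i + j)) = Z (int i + j)" "w (q' + (int i + j)) = Z (int i + j)"
          using \<open>matches Z q\<close> q' unfolding matches_def occurs_at_def by blast+
        then show "w (j + (q + int i)) = w (j + (q' + int i))"
          by (simp add: algebra_simps)
      qed
    qed
    have "int_sum (\<phi> k) (q + int i) - int_sum (\<phi> k) q = int_sum (\<phi> k) (q' + int i) - int_sum (\<phi> k) q'"
      if "i \<le> L" for i
      using that
    proof (induction i)
      case (Suc i)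
      then show ?case
        using agr[of i] int_sum_step[of "\<phi> k" "q + int i"] int_sum_step[of "\<phi> k" "q' + int i"]
        by (simp add: algebra_simps)
    qed simp
    then show ?thesis
      by (simp add: S_def q'_def)
  qed
  obtain a b c where abc: "a \<noteq> 0 \<or> b \<noteq> 0 \<or> c \<noteq> 0"
    "a * S bl 0 + b * S bl 1 + c * S bl 2 = 0" "a * S bl' 0 + b * S bl' 1 + c * S bl' 2 = 0"
    using two_equations_three_unknowns[of "S bl" "S bl'"] by blast
  define H where "H n = a * int_sum (\<phi> 0) n + b * int_sum (\<phi> 1) n + c * int_sum (\<phi> 2) n" for n
  define \<theta> where "\<theta> n = a * \<phi> 0 n + b * \<phi> 1 n + c * \<phi> 2 n" for n
  have Hdiff: "H m - H n = a * (int_sum (\<phi> 0) m - int_sum (\<phi> 0) n)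
      + b * (int_sum (\<phi> 1) m - int_sum (\<phi> 1) n) + c * (int_sum (\<phi> 2) m - int_sum (\<phi> 2) n)" for m n
    by (simp add: H_def algebra_simps)
  have step: "H (n + 1) - H n = \<theta> n" for n
    by (simp only: Hdiff int_sum_step \<theta>_def)
  have "local_function w R \<theta>"
    unfolding local_function_def \<theta>_def using local_functionD[OF loc] by metis
  moreover have "finite (range H)"
  proof (rule finite_range_if_block_sums_0[OF \<open>local_function w R \<theta>\<close> step L])
    fix x y :: int assume "x \<le> y"
    then obtain q and t :: nat where q: "q \<le> x" "y < q + int t * int L"
      "\<And>i. i < t \<Longrightarrow> matches bl (q + int i * int L) \<or> matches bl' (q + int i * int L)"
      using blocks unfolding matches_def by blast
    have "H (q + int i * int L + int L) = H (q + int i * int L)" if "i < t" for i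
      using q(3)[OF that] Hdiff[of "q + int i * int L + int L" "q + int i * int L"] S abc(2,3) by auto
    then show "\<exists>q. \<exists>t::nat. q \<le> x \<and> y < q + int t * int L \<and>
      (\<forall>i<t. H (q + int i * int L + int L) = H (q + int i * int L))"
      using q by blast
  qed
  ultimately have "\<exists>M. local_function w M H"
    using local_function_if_finite_range[where H = H and \<phi> = \<theta>, OF rec _ step] by blast
  then show ?thesis
    using abc(1) step unfolding \<theta>_def by blast
qed

section \<open>The block structure of the constructed word\<close>

lemma nth_concat_uniform:
  assumes "\<And>x. x \<in> set xs \<Longrightarrow> length x = L" "i < length xs" "r < L"
  shows "concat xs ! (i * L + r) = xs ! i ! r"
  using assms
proof (induction xs arbitrary: i)
  case (Cons x xs)
  show ?case
  proof (cases i)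
    case (Suc j)
    then show ?thesis
      using Cons by (simp add: nth_append)
  qed (use Cons in \<open>simp add: nth_append\<close>)
qed simp

lemma length_concat_uniform:
  "(\<And>x. x \<in> set xs \<Longrightarrow> length x = L) \<Longrightarrow> length (concat xs) = length xs * L"
  by (induction xs) auto

locale word_tower =
  fixes w :: "int \<Rightarrow> letter" and f u v :: "nat \<Rightarrow> letter list" and g :: "nat \<Rightarrow> bool list"
    and p s :: "nat \<Rightarrow> letter list" and pos :: "nat \<Rightarrow> int"
  assumes constr: "word_construction f u v g"
    and split: "\<And>k. k \<ge> 1 \<Longrightarrow> f (Suc k) = p k @ u k @ s k"
    and pos: "\<And>k. k \<ge> 1 \<Longrightarrow> pos k = pos (Suc k) + int (length (u k @ u k @ v k @ p k))"
    and occ: "\<And>k i. k \<ge> 1 \<Longrightarrow> i < length (u k) \<Longrightarrow> w (pos k + int i) = u k ! i"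
begin

lemma u_Suc: "k \<ge> 1 \<Longrightarrow> u (Suc k) = u k @ u k @ v k @ f (Suc k) @ v k @ u k @ u k"
  and v_Suc: "k \<ge> 1 \<Longrightarrow> v (Suc k) = u k @ v k @ v k @ f (Suc k) @ v k @ u k @ u k"
  and f_Suc: "k \<ge> 1 \<Longrightarrow> f (Suc k) = substitute (u k) (v k) (g k)"
  using constr unfolding word_construction_def by blast+

lemma length_v: "k \<ge> 1 \<Longrightarrow> length (v k) = length (u k)"
proof (induction k rule: dec_induct)
  case base
  then show ?case using constr by (simp add: word_construction_def)
next
  case (step k)
  then show ?case by (simp add: u_Suc v_Suc)
qed

lemma length_u_ge: "k \<ge> 1 \<Longrightarrow> length (u k) \<ge> k"
proof (induction k rule: dec_induct)
  case base
  then show ?case using constr by (simp add: word_construction_def)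
next
  case (step k)
  then show ?case by (simp add: u_Suc)
qed

text \<open>Every level adds at least one letter on the left, and likewise on the right in
  \<open>pos_end_ge\<close>. These linear bounds are crude, but they already show that the words
  \<open>u k\<close> exhaust the line.\<close>

lemma pos_le: "k \<ge> 1 \<Longrightarrow> pos k \<le> pos 1 - int (k - 1)"
proof (induction k rule: dec_induct)
  case base
  then show ?case by simp
next
  case (step k)
  then show ?case using pos[of k] length_u_ge[of k] by simp
qed

lemma pos_end_ge: "k \<ge> 1 \<Longrightarrow> pos k + int (length (u k)) \<ge> pos 1 + int k"
proof (induction k rule: dec_induct)
  case base
  then show ?case using length_u_ge[of 1] by simp
next
  case (step k)
  then show ?case using pos[of k] length_u_ge[of k] by (simp add: u_Suc split)
qed

lemma interval_in_u:
  obtains j where "j \<ge> K" "j \<ge> 1" "pos j \<le> a" "b < pos j + int (length (u j))"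
proof -
  define j where "j = K + 1 + nat (pos 1 - a) + nat (b - pos 1)"
  have j: "j \<ge> K" "j \<ge> 1" by (simp_all add: j_def)
  moreover have "pos 1 - a \<le> int (j - 1)" "b - pos 1 < int j"
    by (simp_all add: j_def)
  then have "pos j \<le> a" "b < pos j + int (length (u j))"
    using pos_le[OF j(2)] pos_end_ge[OF j(2)] by linarith+
  ultimately show thesis using that by blast
qed

text \<open>One level up, \<open>u\<close> and \<open>v\<close> are concatenations of words of the
  current level, the factor \<open>f (Suc j)\<close> included, being an image under the
  substitution. Replacing each of these words by its own list of blocks carries the decomposition
  upwards.\<close>

lemma concat_decomposition:
  assumes "K \<ge> 1" "K \<le> j"
  shows "\<exists>xs. u j = concat xs \<and> set xs \<subseteq> {u K, v K}"
    and "\<exists>xs. v j = concat xs \<and> set xs \<subseteq> {u K, v K}"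
proof -
  have "(\<exists>xs. u j = concat xs \<and> set xs \<subseteq> {u K, v K}) \<and> (\<exists>xs. v j = concat xs \<and> set xs \<subseteq> {u K, v K})"
    using assms(2)
  proof (induction j rule: dec_induct)
    case base
    have "u K = concat [u K]" "v K = concat [v K]" by simp_all
    then show ?case by (metis empty_set insert_subset list.simps(15) subset_insertI2 subset_refl empty_subsetI insertI1)
  next
    case (step j)
    then obtain xs ys where xs: "u j = concat xs" "set xs \<subseteq> {u K, v K}"
      and ys: "v j = concat ys" "set ys \<subseteq> {u K, v K}" by blast
    define zs where "zs = concat (map (\<lambda>d. if d then ys else xs) (g j))"
    have "concat (concat (map (\<lambda>d. if d then ys else xs) h)) = substitute (u j) (v j) h" for h
      unfolding substitute_def using xs ys by (induction h) auto
    then have "concat zs = substitute (u j) (v j) (g j)"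
      by (simp add: zs_def)
    then have zs: "concat zs = f (Suc j)" "set zs \<subseteq> {u K, v K}"
      using xs ys f_Suc[of j] step assms(1) by (auto simp: zs_def split: if_splits)
    have "u (Suc j) = concat (xs @ xs @ ys @ zs @ ys @ xs @ xs)"
      "v (Suc j) = concat (xs @ ys @ ys @ zs @ ys @ xs @ xs)"
      using xs ys zs u_Suc[of j] v_Suc[of j] step assms(1) by simp_all
    moreover have "set (xs @ xs @ ys @ zs @ ys @ xs @ xs) \<subseteq> {u K, v K}"
      "set (xs @ ys @ ys @ zs @ ys @ xs @ xs) \<subseteq> {u K, v K}"
      using xs ys zs by auto
    ultimately show ?case by blast
  qed
  then show "\<exists>xs. u j = concat xs \<and> set xs \<subseteq> {u K, v K}" "\<exists>xs. v j = concat xs \<and> set xs \<subseteq> {u K, v K}"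
    by blast+
qed

text \<open>Both \<open>u (k + 1)\<close> and \<open>v (k + 1)\<close> begin and end with \<open>u k\<close>, so each of their occurrences in the
  decomposition extends to one of \<open>u k @ x @ u k\<close>.\<close>

lemma bordered_blocks:
  assumes k: "k \<ge> 1" and ab: "a \<le> b"
  defines "L \<equiv> length (u (Suc k))"
  shows "\<exists>q. \<exists>t::nat. q \<le> a \<and> b < q + int t * int L \<and> (\<forall>i<t. \<exists>x\<in>{u (Suc k), v (Suc k)}.
    \<forall>r<length (u k) + L + length (u k).
      w (q + int i * int L - int (length (u k)) + int r) = (u k @ x @ u k) ! r)"
proof -
  let ?l = "length (u k)"
  have lL: "?l \<le> L" using k by (simp add: L_def u_Suc)
  \<comment> \<open>The margin of \<open>L\<close> letters on both sides leaves room for dropping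
    the first and the last block.\<close>
  obtain j where j: "j \<ge> Suc k" "j \<ge> 1" "pos j \<le> a - int L" "b + int L < pos j + int (length (u j))"
    using interval_in_u[of "Suc k" "a - int L" "b + int L"] by blast
  obtain xs where xs: "u j = concat xs" "set xs \<subseteq> {u (Suc k), v (Suc k)}"
    using concat_decomposition(1)[of "Suc k" j] j by auto
  have len: "length x = L" if "x \<in> set xs" for x
    using that xs(2) length_v[of "Suc k"] by (auto simp: L_def)
  have lenu: "length (u j) = length xs * L"
    using xs(1) length_concat_uniform[OF len] by simp
  have wxs: "w (pos j + int (i * L + r)) = xs ! i ! r" if "i < length xs" "r < L" for i r
  proof -
    have "i * L + r < Suc i * L" using that by simp
    also have "\<dots> \<le> length xs * L" using that by (intro mult_right_mono) auto
    finally show ?thesis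
      using occ[of j "i * L + r"] j lenu nth_concat_uniform[OF len that] xs(1) by simp
  qed
  have L0: "L > 0" using length_u_ge[of "Suc k"] unfolding L_def by linarith
  \<comment> \<open>At least two blocks are needed so that the natural subtraction in
    \<open>t\<close> is not truncated.\<close>
  have "2 * L \<le> length xs * L"
    using j lenu ab by linarith
  then have lenxs: "length xs \<ge> 2"
    using L0 by (simp only: mult_le_cancel2)
  \<comment> \<open>The tiling starts at the second block and stops before the last one: every block
    kept then has neighbours on both sides, and these supply its borders.\<close>
  define q t where "q = pos j + int L" and "t = length xs - 2"
  have "q \<le> a" using j by (simp add: q_def)
  moreover have "b < q + int t * int L"
  proof -
    have "int t * int L = int (length xs) * int L - 2 * int L"
      using lenxs by (simp add: t_def of_nat_diff algebra_simps)
    then show ?thesis using j lenu by (simp add: q_def)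
  qed
  moreover have "\<exists>x\<in>{u (Suc k), v (Suc k)}. \<forall>r<?l + L + ?l.
      w (q + int i * int L - int ?l + int r) = (u k @ x @ u k) ! r" if i: "i < t" for i
  proof -
    let ?x = "xs ! Suc i"
    have idx: "i < length xs" "Suc i < length xs" "Suc (Suc i) < length xs"
      using i by (auto simp: t_def)
    then have mem: "xs ! i \<in> {u (Suc k), v (Suc k)}" "?x \<in> {u (Suc k), v (Suc k)}"
      "xs ! Suc (Suc i) \<in> {u (Suc k), v (Suc k)}"
      using xs(2) by (meson nth_mem subsetD)+
    have "w (q + int i * int L - int ?l + int r) = (u k @ ?x @ u k) ! r" if r: "r < ?l + L + ?l" for r
    proof -
      consider "r < ?l" | "?l \<le> r" "r < ?l + L" | "?l + L \<le> r" "r < ?l + L + ?l"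
        using r by linarith
      then show ?thesis
      proof cases
        case 1
        have "\<exists>y. xs ! i = y @ u k" 
          using mem(1) k u_Suc[of k] v_Suc[of k] by (metis append.assoc insertE singletonD)
        then obtain y where y: "xs ! i = y @ u k" by blast
        have ly: "length y = L - ?l"
          using len[of "xs ! i"] idx y by (metis add_diff_cancel_right' length_append nth_mem)
        have eq: "q + int i * int L - int ?l + int r = pos j + int (i * L + (L - ?l + r))"
          using lL by (simp add: q_def of_nat_diff)
        have "w (q + int i * int L - int ?l + int r) = xs ! i ! (L - ?l + r)"
          unfolding eq using wxs[of i "L - ?l + r"] idx 1 lL by simp
        also have "\<dots> = u k ! r" using ly y by (simp add: nth_append)
        finally show ?thesis using 1 by (simp add: nth_append)
      next
        case 2
        have eq: "q + int i * int L - int ?l + int r = pos j + int (Suc i * L + (r - ?l))"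
          using 2 by (simp add: q_def of_nat_diff algebra_simps)
        have "w (q + int i * int L - int ?l + int r) = ?x ! (r - ?l)"
          unfolding eq using wxs[of "Suc i" "r - ?l"] idx 2 by simp
        moreover have "r - ?l < L" using 2 by linarith
        ultimately show ?thesis using 2 len[of ?x] idx by (simp add: nth_append)
      next
        case 3
        have "\<exists>y. xs ! Suc (Suc i) = u k @ y"
          using mem(3) k u_Suc[of k] v_Suc[of k] by (metis insertE singletonD)
        then obtain y where y: "xs ! Suc (Suc i) = u k @ y" by blast
        have eq: "q + int i * int L - int ?l + int r = pos j + int (Suc (Suc i) * L + (r - ?l - L))"
          using 3 by (simp add: q_def of_nat_diff algebra_simps)
        have "w (q + int i * int L - int ?l + int r) = xs ! Suc (Suc i) ! (r - ?l - L)"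
          unfolding eq using wxs[of "Suc (Suc i)" "r - ?l - L"] idx 3 lL by simp
        also have "\<dots> = u k ! (r - ?l - L)"
        proof -
          have "r - ?l - L < ?l" using 3 by linarith
          then show ?thesis using y by (simp add: nth_append)
        qed
        moreover have "\<not> r < ?l" "\<not> r - ?l < L" using 3 by linarith+
        ultimately show ?thesis using len[of ?x] idx by (simp add: nth_append)
      qed
    qed
    then show ?thesis using mem(2) by blast
  qed
  ultimately show ?thesis by blast
qed

lemma two_block: "two_block w"
  unfolding two_block_def
proof
  fix R :: nat
  \<comment> \<open>As \<open>u k\<close> has at least \<open>k\<close> letters, the borders at this
    level cover a context of \<open>R\<close> letters.\<close>
  define k where "k = Suc R"
  define L where "L = length (u (Suc k))"
  have k: "k \<ge> 1" "R \<le> length (u k)"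
    using length_u_ge[of k] by (auto simp: k_def)
  have L: "L > 0" using length_u_ge[of "Suc k"] unfolding L_def by linarith
  \<comment> \<open>The bordered word re-indexed so that 0 is the start of the block itself.
    Positions before the left border are sent to index 0 by \<open>nat\<close>; they lie outside the
    required context.\<close>
  define bl where "bl x r = (u k @ x @ u k) ! nat (r + int (length (u k)))" for x r
  have "\<exists>q. \<exists>t::nat. q \<le> a \<and> b < q + int t * int L \<and>
      (\<forall>i<t. occurs_at w R L (bl (u (Suc k))) (q + int i * int L) \<or>
        occurs_at w R L (bl (v (Suc k))) (q + int i * int L))"
    if ab: "a \<le> b" for a b
  proof -
    obtain q t where q: "q \<le> a" "b < q + int t * int L"
      "\<And>i. i < t \<Longrightarrow> \<exists>x\<in>{u (Suc k), v (Suc k)}. \<forall>r<length (u k) + L + length (u k).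
        w (q + int i * int L - int (length (u k)) + int r) = (u k @ x @ u k) ! r"
      using bordered_blocks[OF k(1) ab] unfolding L_def by blast
    have "w (q + int i * int L + r) = bl x r"
      if "\<forall>r<length (u k) + L + length (u k).
        w (q + int i * int L - int (length (u k)) + int r) = (u k @ x @ u k) ! r"
        "- int R \<le> r" "r < int (L + R)" for i x r
    proof -
      have "nat (r + int (length (u k))) < length (u k) + L + length (u k)"
        using that(2,3) k(2) by linarith
      moreover have "int (nat (r + int (length (u k)))) = r + int (length (u k))"
        using that(2) k(2) by simp
      ultimately have "w (q + int i * int L - int (length (u k)) + (r + int (length (u k)))) = bl x r"
        using that(1) unfolding bl_def by metis
      then show ?thesis by (simp add: add.assoc)
    qed
    then have "occurs_at w R L (bl (u (Suc k))) (q + int i * int L) \<or>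
        occurs_at w R L (bl (v (Suc k))) (q + int i * int L)" if "i < t" for i
      using q(3)[OF that] unfolding occurs_at_def by blast
    then show ?thesis
      using q(1,2) by blast
  qed
  then show "\<exists>L>0. \<exists>x y. \<forall>a b. a \<le> b \<longrightarrow>
     (\<exists>q. \<exists>t::nat. q \<le> a \<and> b < q + int t * int L \<and>
        (\<forall>i<t. occurs_at w R L x (q + int i * int L) \<or> occurs_at w R L y (q + int i * int L)))"
    using L by blast
qed

text \<open>The window around the origin lies in some \<open>u k\<close>, and a copy of
  \<open>u k\<close> borders every block one level higher. So the window recurs near every position,
  at a distance bounded in terms of \<open>k\<close>.\<close>

lemma uniformly_recurrent: "uniformly_recurrent w"
  unfolding uniformly_recurrent_def
proof
  fix N :: nat
  obtain k where k: "k \<ge> 1" "pos k \<le> - int N" "int N < pos k + int (length (u k))"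
    using interval_in_u[of 1 "- int N" "int N"] by blast
  define L where "L = length (u (Suc k))"
  have L: "L > 0" using length_u_ge[of "Suc k"] unfolding L_def by linarith
  have "\<exists>d. \<bar>d - n\<bar> \<le> int (L + length (u k) + nat \<bar>pos k\<bar>) \<and> agree N (translate d w) w" for n
  proof -
    obtain q t where q: "q \<le> n" "n < q + int t * int L"
      "\<And>i. i < t \<Longrightarrow> \<exists>x\<in>{u (Suc k), v (Suc k)}. \<forall>r<length (u k) + L + length (u k).
        w (q + int i * int L - int (length (u k)) + int r) = (u k @ x @ u k) ! r"
      using bordered_blocks[OF k(1), of n n] unfolding L_def by auto
    define i where "i = nat ((n - q) div int L)"
    have "n - q < int t * int L" using q by linarith
    then have "(n - q) div int L < int t"
      using L by (simp add: int_div_less)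
    moreover have ge: "0 \<le> (n - q) div int L"
      using q L by (simp add: pos_imp_zdiv_nonneg_iff)
    ultimately have i: "i < t" by (simp add: i_def nat_less_iff)
    \<comment> \<open>The start of the left border of the block that contains \<open>n\<close>.
      Since \<open>u k\<close> sits at \<open>pos k\<close> in the reference position, the required
      translation is \<open>e - pos k\<close>.\<close>
    define e where "e = q + int i * int L - int (length (u k))"
    have "n - q = int i * int L + (n - q) mod int L"
      using ge by (simp add: i_def)
    moreover have "0 \<le> (n - q) mod int L" "(n - q) mod int L < int L"
      using L by auto
    ultimately have e: "\<bar>e - n\<bar> \<le> int L + int (length (u k))"
      by (simp add: e_def)
    have eu: "w (e + int r) = u k ! r" if "r < length (u k)" for r
      using q(3)[OF i] that by (auto simp: e_def nth_append)
    have "agree N (translate (e - pos k) w) w"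
      unfolding agree_def translate_def
    proof (intro allI impI)
      fix j assume "\<bar>j\<bar> \<le> int N"
      then have r: "nat (j - pos k) < length (u k)" "j = pos k + int (nat (j - pos k))"
        using k by auto
      define r' where "r' = nat (j - pos k)"
      have "w (pos k + int r' + (e - pos k)) = w (pos k + int r')"
        using eu[of r'] occ[OF k(1), of r'] r(1) by (simp add: r'_def[symmetric] algebra_simps)
      then show "w (j + (e - pos k)) = w j"
        using r(2) by (simp add: r'_def)
    qed
    moreover have "\<bar>e - pos k - n\<bar> \<le> int (L + length (u k) + nat \<bar>pos k\<bar>)"
      using e by simp
    ultimately show ?thesis by blast
  qed
  then show "\<exists>L::nat. \<forall>n. \<exists>d. \<bar>d - n\<bar> \<le> int L \<and> agree N (translate d w) w" by blast
qed

end

lemma constructed_word_tower: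
  assumes "constructed_word w"
  obtains f u v g p s pos where "word_tower w f u v g p s pos"
  using assms unfolding constructed_word_def word_tower_def by blast


section \<open>The suspension space\<close>

text \<open>A basic open set restricts finitely many coordinates, all of which fit into a central
  window; conversely a central window is itself such a restriction.\<close>

lemma openin_full_shift:
  "openin full_shift S \<longleftrightarrow> (\<forall>x\<in>S. \<exists>N. \<forall>y. agree N x y \<longrightarrow> y \<in> S)"
proof
  assume S: "openin full_shift S"
  show "\<forall>x\<in>S. \<exists>N. \<forall>y. agree N x y \<longrightarrow> y \<in> S"
  proof
    fix x assume "x \<in> S"
    then obtain U where U: "finite {i. U i \<noteq> UNIV}" "\<And>i. x i \<in> U i" "\<And>y. (\<And>i. y i \<in> U i) \<Longrightarrow> y \<in> S"
      using S unfolding full_shift_def openin_product_topology_alt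
      by (fastforce simp: PiE_UNIV_domain subset_iff)
    then obtain N where N: "\<And>i. U i \<noteq> UNIV \<Longrightarrow> nat \<bar>i\<bar> \<le> N"
      using finite_nat_set_iff_bounded_le[of "(\<lambda>i. nat \<bar>i\<bar>) ` {i. U i \<noteq> UNIV}"] by auto
    have "y \<in> S" if y: "agree N x y" for y
    proof (rule U(3))
      show "y i \<in> U i" for i
      proof (cases "U i = UNIV")
        case False
        then have "\<bar>i\<bar> \<le> int N" using N[of i] by simp
        then show ?thesis using y U(2)[of i] by (simp add: agree_def)
      qed simp
    qed
    then show "\<exists>N. \<forall>y. agree N x y \<longrightarrow> y \<in> S" by blast
  qed
next
  assume S: "\<forall>x\<in>S. \<exists>N. \<forall>y. agree N x y \<longrightarrow> y \<in> S"
  show "openin full_shift S"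
    unfolding full_shift_def openin_product_topology_alt
  proof
    fix x assume "x \<in> S"
    then obtain N where N: "\<And>y. agree N x y \<Longrightarrow> y \<in> S" using S by blast
    define U where "U i = (if \<bar>i\<bar> \<le> int N then {x i} else UNIV)" for i
    have "{i. U i \<noteq> UNIV} \<subseteq> {- int N..int N}"
      by (auto simp: U_def)
    then have "finite {i. U i \<noteq> UNIV}"
      by (rule finite_subset) simp
    moreover have "y \<in> S" if "\<And>i. y i \<in> U i" for y
    proof (rule N)
      have "x i = y i" if "\<bar>i\<bar> \<le> int N" for i
        using that \<open>y i \<in> U i\<close> by (simp add: U_def)
      then show "agree N x y" by (simp add: agree_def)
    qed
    moreover have "x i \<in> U i" for i by (simp add: U_def)
    ultimately show "\<exists>U. finite {i \<in> UNIV. U i \<noteq> topspace (discrete_topology UNIV)} \<and>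
        (\<forall>i\<in>UNIV. openin (discrete_topology UNIV) (U i)) \<and> x \<in> Pi\<^sub>E UNIV U \<and> Pi\<^sub>E UNIV U \<subseteq> S"
      by (intro exI[of _ U]) (auto simp: PiE_UNIV_domain)
  qed
qed

lemma topspace_full_shift [simp]: "topspace full_shift = UNIV"
  by (simp add: full_shift_def)

lemma openin_agree: "openin full_shift {y. agree N x y}"
  unfolding openin_full_shift using agree_trans by blast

lemma Theta_iff: "x \<in> Theta w \<longleftrightarrow> (\<forall>N. \<exists>n. agree N x (translate n w))"
proof
  assume x: "x \<in> Theta w"
  show "\<forall>N. \<exists>n. agree N x (translate n w)"
  proof
    fix N
    have "\<exists>y. y \<in> {(\<lambda>i. w (i + n)) | n. True} \<and> y \<in> {y. agree N x y}"
      using x openin_agree[of N x] agree_refl[of N x] unfolding Theta_def in_closure_of by blast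
    then show "\<exists>n. agree N x (translate n w)"
      unfolding translate_def by blast
  qed
next
  assume *: "\<forall>N. \<exists>n. agree N x (translate n w)"
  have "\<exists>y. y \<in> {(\<lambda>i. w (i + n)) | n. True} \<and> y \<in> T" if T: "x \<in> T" "openin full_shift T" for T
  proof -
    obtain N where "\<And>y. agree N x y \<Longrightarrow> y \<in> T"
      using T unfolding openin_full_shift by blast
    moreover obtain n where "agree N x (translate n w)" using * by blast
    ultimately have "translate n w \<in> T" by blast
    then show ?thesis
      unfolding translate_def by blast
  qed
  then show "x \<in> Theta w"
    unfolding Theta_def in_closure_of by simp
qed

lemma translate_Theta: "x \<in> Theta w \<Longrightarrow> translate n x \<in> Theta w"
proof -
  assume x: "x \<in> Theta w"
  have "\<exists>m. agree N (translate n x) (translate m w)" for N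
  proof -
    obtain m where "agree (N + nat \<bar>n\<bar>) x (translate m w)"
      using x unfolding Theta_iff by blast
    then have "agree N (translate n x) (translate n (translate m w))"
      by (rule agree_translate) simp
    then show ?thesis by auto
  qed
  then show ?thesis unfolding Theta_iff by blast
qed

lemma self_in_Theta: "w \<in> Theta w"
  unfolding Theta_iff by (metis agree_refl translate_0)

section \<open>Classes and neighbourhoods in the suspension\<close>

lemma shift_eq_translate: "shift x = translate 1 x"
  by (simp add: shift_def translate_def)

lemma translate_inverse: "y = translate 1 x \<longleftrightarrow> x = translate (- 1) y"
  by (auto simp: translate_def)

text \<open>A step can be undone by translating back, so chains of forward and backward steps never
  leave the two-sided orbit of \<open>(x, t)\<close>.\<close>

lemma equivclp_suspension_step:
  assumes x: "x \<in> Theta w"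
  shows "equivclp (suspension_step w) (x, t) b \<longleftrightarrow> (\<exists>n. b = (translate n x, t - of_int n))"
proof
  assume "equivclp (suspension_step w) (x, t) b"
  then show "\<exists>n. b = (translate n x, t - of_int n)"
  proof (induction rule: equivclp_induct)
    case base
    show ?case by (rule exI[of _ 0]) simp
  next
    case (step b c)
    then obtain n where n: "b = (translate n x, t - of_int n)" by blast
    from step(2) show ?case
    proof
      assume "suspension_step w b c"
      then have "c = (translate (n + 1) x, t - of_int (n + 1))"
        using n by (simp add: suspension_step_def shift_eq_translate add.commute)
      then show ?thesis by blast
    next
      assume "suspension_step w c b"
      then have "fst b = translate 1 (fst c)" "snd b = snd c - 1"
        by (simp_all add: suspension_step_def shift_eq_translate)
      then have "fst c = translate (- 1) (fst b)" "snd c = snd b + 1"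
        using translate_inverse by auto
      then have "c = (translate (n - 1) x, t - of_int (n - 1))"
        using n by (simp add: prod_eq_iff)
      then show ?thesis by blast
    qed
  qed
next
  have step: "suspension_step w (translate n x, t - of_int n) (translate (n + 1) x, t - of_int (n + 1))" for n
    using translate_Theta[OF x] by (simp add: suspension_step_def shift_eq_translate add.commute)
  have "equivclp (suspension_step w) (x, t) (translate n x, t - of_int n)" for n
  proof (induction n rule: int_induct[of _ 0])
    case base
    then show ?case by simp
  next
    case (step1 i)
    then show ?case
      by (intro equivclp_into_equivclp[OF step1(2)] disjI1 step)
  next
    case (step2 i)
    have "suspension_step w (translate (i - 1) x, t - of_int (i - 1)) (translate i x, t - of_int i)"
      using step[of "i - 1"] by simp
    then show ?case
      by (intro equivclp_into_equivclp[OF step2(2)] disjI2)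
  qed
  then show "\<exists>n. b = (translate n x, t - of_int n) \<Longrightarrow> equivclp (suspension_step w) (x, t) b"
    by blast
qed

lemma suspension_class_eq_iff:
  assumes "x \<in> Theta w"
  shows "suspension_class w (x, t) = suspension_class w (y, s) \<longleftrightarrow>
    (\<exists>n. y = translate n x \<and> s = t - of_int n)"
proof -
  have "suspension_class w (x, t) = suspension_class w (y, s) \<longleftrightarrow>
    equivclp (suspension_step w) (x, t) (y, s)"
    unfolding suspension_class_def
    by (metis (mono_tags, lifting) Collect_cong equivclp_refl equivclp_sym equivclp_trans mem_Collect_eq)
  then show ?thesis
    by (simp add: equivclp_suspension_step[OF assms])
qed

lemma topspace_Omega: "topspace (Omega w) = {suspension_class w (x, t) | x t. x \<in> Theta w}"
proof
  show "topspace (Omega w) \<subseteq> {suspension_class w (x, t) | x t. x \<in> Theta w}"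
    unfolding Omega_def topology_generated_by_topspace suspension_base_def
    using openin_subset by fastforce
  have "openin (subtopology full_shift (Theta w)) (Theta w)"
    using openin_topspace[of "subtopology full_shift (Theta w)"] by simp
  then have "suspension_class w ` (Theta w \<times> UNIV) \<in> suspension_base w"
    unfolding suspension_base_def by blast
  then show "{suspension_class w (x, t) | x t. x \<in> Theta w} \<subseteq> topspace (Omega w)"
    unfolding Omega_def topology_generated_by_topspace by blast
qed

text \<open>This is continuity of the quotient map in coordinates. The base enters
  \<open>Omega\<close> only as a generating family, hence the induction over generated open sets. A
  generator may contain the class through another representative, \<open>n\<close> letters away;
  enlarging the window by the absolute value of \<open>n\<close> makes up for this.\<close>

lemma openin_Omega_nbhd:
  assumes "openin (Omega w) G" "x \<in> Theta w" "suspension_class w (x, t) \<in> G"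
  shows "\<exists>N. \<exists>e>0. \<forall>y\<in>Theta w. \<forall>s. agree N x y \<and> \<bar>s - t\<bar> < e \<longrightarrow> suspension_class w (y, s) \<in> G"
proof -
  have "generate_topology_on (suspension_base w) G"
    using assms(1) unfolding Omega_def by (rule openin_topology_generated_by)
  then show ?thesis
    using assms(2,3)
  proof (induction arbitrary: x t)
    case Empty
    then show ?case by simp
  next
    case (Int a b)
    obtain N e where 1: "e > 0" "\<And>y s. y \<in> Theta w \<Longrightarrow> agree N x y \<Longrightarrow> \<bar>s - t\<bar> < e \<Longrightarrow> suspension_class w (y, s) \<in> a"
      using Int.IH(1)[of x t] Int.prems by blast
    obtain N' e' where 2: "e' > 0" "\<And>y s. y \<in> Theta w \<Longrightarrow> agree N' x y \<Longrightarrow> \<bar>s - t\<bar> < e' \<Longrightarrow> suspension_class w (y, s) \<in> b"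
      using Int.IH(2)[of x t] Int.prems by blast
    show ?case
      using 1 2 agree_mono[of "max N N'" x]
      by (intro exI[of _ "max N N'"] exI[of _ "min e e'"]) auto
  next
    case (UN K)
    then obtain k where k: "k \<in> K" "suspension_class w (x, t) \<in> k" by blast
    then show ?case
      using UN.IH[OF k(1) UN.prems(1) k(2)] by blast
  next
    case (Basis b)
    then obtain V I where VI: "b = suspension_class w ` (V \<times> I)"
      "openin (subtopology full_shift (Theta w)) V" "open I"
      unfolding suspension_base_def by blast
    then obtain z r where zr: "z \<in> V" "r \<in> I" "suspension_class w (x, t) = suspension_class w (z, r)"
      using Basis.prems by blast
    then obtain n where n: "z = translate n x" "r = t - of_int n"
      using suspension_class_eq_iff[OF Basis.prems(1)] by blast
    obtain S where S: "openin full_shift S" "V = S \<inter> Theta w"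
      using VI(2) by (auto simp: openin_subtopology)
    obtain N where N: "\<And>y. agree N z y \<Longrightarrow> y \<in> S"
      using S zr(1) unfolding openin_full_shift by blast
    obtain e where e: "e > 0" "\<And>s. \<bar>s - r\<bar> < e \<Longrightarrow> s \<in> I"
      using VI(3) zr(2) unfolding open_dist dist_real_def by blast
    have "suspension_class w (y, s) \<in> b"
      if y: "y \<in> Theta w" "agree (N + nat \<bar>n\<bar>) x y" "\<bar>s - t\<bar> < e" for y s
    proof -
      have "agree N (translate n x) (translate n y)"
        using y(2) by (rule agree_translate) simp
      then have "translate n y \<in> V"
        using N S n y translate_Theta by blast
      moreover have "s - of_int n \<in> I"
        using e(2) y(3) n by simp
      moreover have "suspension_class w (y, s) = suspension_class w (translate n y, s - of_int n)"
        using suspension_class_eq_iff[OF y(1)] by blast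
      ultimately show ?thesis
        using VI(1) by blast
    qed
    then show ?case
      using e(1) by blast
  qed
qed

lemma compact_Theta_times_interval:
  fixes w :: "int \<Rightarrow> letter"
  shows "compact_space (prod_topology (subtopology full_shift (Theta w)) (top_of_set {0..1::real}))"
proof -
  have "UNIV = {La, Lb}"
    using letter.exhaust by auto
  then have "finite (UNIV :: letter set)"
    by (metis finite.emptyI finite.insertI)
  then have "compact_space (full_shift :: (int \<Rightarrow> letter) topology)"
    unfolding full_shift_def by (simp add: compact_space_product_topology compact_space_discrete_topology)
  moreover have "closedin full_shift (Theta w)"
    unfolding Theta_def by (rule closedin_closure_of)
  ultimately have "compact_space (subtopology full_shift (Theta w))"
    using closedin_compact_space compact_space_subtopology by blast
  then show ?thesis
    by (simp add: compact_space_prod_topology compact_space_subtopology)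
qed

text \<open>A Lebesgue number on the compact set \<open>Theta w\<close> times the unit interval,
  which meets every class. The neighbourhoods are taken in \<open>Theta w\<close> times the whole
  line, so \<open>s\<close> may leave the unit interval.\<close>

lemma Omega_Lebesgue_number:
  fixes w :: "int \<Rightarrow> letter"
  assumes U: "open_cover (Omega w) \<U>"
  shows "\<exists>N. \<exists>m>0::nat. \<forall>x\<in>Theta w. \<forall>t\<in>{0..1}. \<exists>G\<in>\<U>. \<forall>y\<in>Theta w. \<forall>s.
    agree N x y \<and> \<bar>s - t\<bar> < 1 / m \<longrightarrow> suspension_class w (y, s) \<in> G"
proof -
  have "\<exists>G N e. G \<in> \<U> \<and> e > 0 \<and>
      (\<forall>y\<in>Theta w. \<forall>s. agree N x y \<and> \<bar>s - t\<bar> < e \<longrightarrow> suspension_class w (y, s) \<in> G)"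
    if x: "x \<in> Theta w" for x t
  proof -
    obtain G where G: "G \<in> \<U>" "suspension_class w (x, t) \<in> G"
      using U x unfolding open_cover_def topspace_Omega by blast
    moreover have "openin (Omega w) G" using U G(1) by (simp add: open_cover_def)
    ultimately show ?thesis
      using openin_Omega_nbhd[of w G x t] x by blast
  qed
  then obtain G N e where GNe: "\<And>x t. x \<in> Theta w \<Longrightarrow> G x t \<in> \<U>" "\<And>x t. x \<in> Theta w \<Longrightarrow> e x t > (0::real)"
    "\<And>x t y s. x \<in> Theta w \<Longrightarrow> y \<in> Theta w \<Longrightarrow> agree (N x t) x y \<Longrightarrow> \<bar>s - t\<bar> < e x t \<Longrightarrow>
      suspension_class w (y, s) \<in> G x t"
    by metis
  let ?P = "prod_topology (subtopology full_shift (Theta w)) (top_of_set {0..1::real})"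
  \<comment> \<open>Half of the admissible radius is kept in reserve: a point within
    \<open>1 / m\<close> of \<open>t\<close> is still within \<open>e\<close> of the centre of the
    chosen neighbourhood.\<close>
  define W where "W = (\<lambda>(x, t). ({y. agree (N x t) x y} \<inter> Theta w) \<times> ({t - e x t / 2<..<t + e x t / 2} \<inter> {0..1}))"
  have "openin ?P (W p)" if "p \<in> Theta w \<times> {0..1}" for p
  proof -
    obtain x t where p: "p = (x, t)" by fastforce
    have "openin (subtopology full_shift (Theta w)) ({y. agree (N x t) x y} \<inter> Theta w)"
      by (rule openin_subtopology_Int[OF openin_agree])
    moreover have "openin (top_of_set {0..1}) ({t - e x t / 2<..<t + e x t / 2} \<inter> {0..1})"
      by (metis Int_commute open_greaterThanLessThan openin_open_Int)
    ultimately show ?thesis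
      unfolding W_def p by (simp add: openin_prod_Times_iff)
  qed
  moreover have "topspace ?P \<subseteq> \<Union>(W ` (Theta w \<times> {0..1}))"
  proof
    fix p assume "p \<in> topspace ?P"
    then obtain x t where p: "p = (x, t)" "x \<in> Theta w" "t \<in> {0..1}" by auto
    then have "p \<in> W (x, t)" using GNe(2)[of x t] by (simp add: W_def)
    then show "p \<in> \<Union>(W ` (Theta w \<times> {0..1}))" using p by blast
  qed
  ultimately obtain \<F> where F: "finite \<F>" "\<F> \<subseteq> W ` (Theta w \<times> {0..1})" "topspace ?P \<subseteq> \<Union>\<F>"
    using spec[OF compact_Theta_times_interval[of w, unfolded compact_space_alt],
        of "W ` (Theta w \<times> {0..1})"] by blast
  then obtain K where K: "finite K" "K \<subseteq> Theta w \<times> {0..1}" "\<F> = W ` K"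
    by (metis finite_subset_image)
  \<comment> \<open>The inserted 0 and 1 keep the maximum and the minimum defined when
    \<open>K\<close> is empty.\<close>
  define N0 where "N0 = Max (insert 0 ((\<lambda>(x, t). N x t) ` K))"
  define e0 where "e0 = Min (insert 1 ((\<lambda>(x, t). e x t / 2) ` K))"
  have e0: "e0 > 0"
    unfolding e0_def using K GNe(2) by (subst Min_gr_iff) auto
  have N0: "N x t \<le> N0" and e0le: "e0 \<le> e x t / 2" if "(x, t) \<in> K" for x t
  proof -
    have "N x t \<in> (\<lambda>(x, t). N x t) ` K" "e x t / 2 \<in> (\<lambda>(x, t). e x t / 2) ` K"
      using that by (auto intro: rev_image_eqI)
    then have "N x t \<in> insert 0 ((\<lambda>(x, t). N x t) ` K)" "e x t / 2 \<in> insert 1 ((\<lambda>(x, t). e x t / 2) ` K)"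
      by blast+
    moreover have "finite (insert 0 ((\<lambda>(x, t). N x t) ` K))" "finite (insert 1 ((\<lambda>(x, t). e x t / 2) ` K))"
      using K(1) by blast+
    ultimately show "N x t \<le> N0" "e0 \<le> e x t / 2"
      unfolding N0_def e0_def using Max_ge Min_le by blast+
  qed
  obtain m :: nat where m: "m > 0" "1 / m < e0"
    using e0 by (metis nat_approx_posE of_nat_0_less_iff zero_less_Suc)
  have "\<exists>G\<in>\<U>. \<forall>y\<in>Theta w. \<forall>s. agree N0 x y \<and> \<bar>s - t\<bar> < 1 / m \<longrightarrow> suspension_class w (y, s) \<in> G"
    if xt: "x \<in> Theta w" "t \<in> {0..1}" for x t
  proof -
    have "(x, t) \<in> topspace ?P" using xt by simp
    then have "(x, t) \<in> \<Union>(W ` K)"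
      using F(3) unfolding K(3) by (rule rev_subsetD)
    then obtain z r where zr: "(z, r) \<in> K" "(x, t) \<in> W (z, r)"
      by (metis UN_E surj_pair)
    then have W: "agree (N z r) z x" "t - r < e z r / 2" "r - t < e z r / 2" and z: "z \<in> Theta w"
      using K(2) by (auto simp: W_def)
    have "suspension_class w (y, s) \<in> G z r" if y: "y \<in> Theta w" "agree N0 x y" "\<bar>s - t\<bar> < 1 / m" for y s
    proof (rule GNe(3)[OF z y(1)])
      show "agree (N z r) z y"
        using agree_trans[OF W(1) agree_mono[OF y(2) N0[OF zr(1)]]] .
      show "\<bar>s - r\<bar> < e z r"
        using y(3) W(2,3) m(2) e0le[OF zr(1)] by linarith
    qed
    then show ?thesis using GNe(1)[OF z] by blast
  qed
  then show ?thesis using m(1) by blast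
qed

section \<open>Flow boxes along the orbit of \<open>w\<close>\<close>

definition cell :: "(int \<Rightarrow> 'a) \<Rightarrow> nat \<Rightarrow> nat \<Rightarrow> (int \<Rightarrow> 'a) \<Rightarrow> int \<Rightarrow> ((int \<Rightarrow> 'a) \<times> real) set set" where
  "cell w N m x j = suspension_class w `
     (({y. agree N x y} \<inter> Theta w) \<times> {(of_int j - 1) / of_nat m<..<(of_int j + 1) / of_nat m})"

text \<open>The centre of the box is the class of \<open>(w, i / m)\<close>: the quotient of
  \<open>i\<close> by \<open>m\<close> counts whole letters and the remainder gives the height
  within a letter. Consecutive indices are thus consecutive in time, also across a letter boundary.
  Different indices may give the same box.\<close>

definition orbit_box :: "(int \<Rightarrow> 'a) \<Rightarrow> nat \<Rightarrow> nat \<Rightarrow> int \<Rightarrow> ((int \<Rightarrow> 'a) \<times> real) set set" where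
  "orbit_box w N m i = cell w N m (translate (i div int m) w) (i mod int m)"

lemma cell_cong: "agree N x y \<Longrightarrow> cell w N m x j = cell w N m y j"
  unfolding cell_def using agree_trans agree_sym by (metis (no_types, lifting) Collect_cong)

lemma orbit_box_eqI:
  "agree N (translate (i div int m) w) (translate (i' div int m) w) \<Longrightarrow> i mod int m = i' mod int m
    \<Longrightarrow> orbit_box w N m i = orbit_box w N m i'"
  unfolding orbit_box_def by (simp add: cell_cong)

lemma orbit_box_mono: "N \<le> M \<Longrightarrow> orbit_box w M m i \<subseteq> orbit_box w N m i"
  unfolding orbit_box_def cell_def using agree_mono by (intro image_mono) blast

lemma openin_orbit_box: "openin (Omega w) (orbit_box w N m i)"
  unfolding Omega_def
proof (rule topology_generated_by_Basis)
  let ?V = "{y. agree N (translate (i div int m) w) y} \<inter> Theta w"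
  have "openin (subtopology full_shift (Theta w)) ?V"
    by (rule openin_subtopology_Int[OF openin_agree])
  then show "orbit_box w N m i \<in> suspension_base w"
    unfolding suspension_base_def orbit_box_def cell_def
    using is_interval_oo open_greaterThanLessThan by blast
qed

text \<open>The integer \<open>n\<close> selects the representative of the class that lies in the
  product. Heights are measured in units of \<open>1 / m\<close>, where a box has radius 1.\<close>

lemma suspension_class_in_box:
  assumes x: "x \<in> Theta w" and m: "m > 0"
  shows "suspension_class w (x, t) \<in> orbit_box w N m i \<longleftrightarrow>
    (\<exists>n. agree N (translate (i div int m) w) (translate n x) \<and>
      \<bar>of_nat m * t - of_int (n * int m + i mod int m)\<bar> < 1)"
    (is "?l \<longleftrightarrow> ?r")
proof -
  have eq: "s \<in> {(of_int j - 1) / of_nat m<..<(of_int j + 1) / of_nat m} \<longleftrightarrow> \<bar>of_nat m * s - of_int j\<bar> < 1"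
    for s :: real and j :: int
    using m by (auto simp: field_simps abs_less_iff)
  have "?l \<longleftrightarrow> (\<exists>y s. agree N (translate (i div int m) w) y \<and> y \<in> Theta w \<and>
      \<bar>of_nat m * s - of_int (i mod int m)\<bar> < 1 \<and> suspension_class w (x, t) = suspension_class w (y, s))"
    unfolding orbit_box_def cell_def image_iff Bex_def mem_Times_iff eq by simp
  also have "\<dots> \<longleftrightarrow> (\<exists>n. agree N (translate (i div int m) w) (translate n x) \<and>
      \<bar>of_nat m * (t - of_int n) - of_int (i mod int m)\<bar> < 1)"
    unfolding suspension_class_eq_iff[OF x] using translate_Theta[OF x] by blast
  finally show ?thesis
    by (simp add: algebra_simps)
qed

lemma open_cover_boxes:
  assumes m: "m > 0"
  shows "open_cover (Omega w) (range (orbit_box w N m))"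
  unfolding open_cover_def
proof
  show "\<forall>U\<in>range (orbit_box w N m). openin (Omega w) U"
    using openin_orbit_box by blast
  then have "\<Union>(range (orbit_box w N m)) \<subseteq> topspace (Omega w)"
    using openin_subset by blast
  moreover have "topspace (Omega w) \<subseteq> \<Union>(range (orbit_box w N m))"
  proof
    fix P assume "P \<in> topspace (Omega w)"
    then obtain x t where P: "P = suspension_class w (x, t)" "x \<in> Theta w"
      unfolding topspace_Omega by blast
    define l where "l = \<lfloor>of_nat m * t\<rfloor>"
    \<comment> \<open>The centre of a box must come from the orbit of \<open>w\<close>, so the
      translate of \<open>x\<close> is replaced by an orbit point with the same window.\<close>
    obtain k where k: "agree N (translate (l div int m) x) (translate k w)"
      using translate_Theta[OF P(2)] unfolding Theta_iff by blast
    define i where "i = k * int m + l mod int m"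
    have i: "i div int m = k" "i mod int m = l mod int m"
      using m by (simp_all add: i_def)
    have "\<bar>of_nat m * t - of_int (l div int m * int m + i mod int m)\<bar> < 1"
      unfolding i by (simp add: l_def) linarith
    then have "P \<in> orbit_box w N m i"
      unfolding P(1) suspension_class_in_box[OF P(2) m] using k i agree_sym by metis
    then show "P \<in> \<Union>(range (orbit_box w N m))" by blast
  qed
  ultimately show "\<Union>(range (orbit_box w N m)) = topspace (Omega w)" by blast
qed

text \<open>A point at height \<open>t\<close> lies in at most the two boxes centred at the multiples of \<open>1 / m\<close>
  next to \<open>t\<close>, and these are consecutive boxes along the orbit of \<open>w\<close>.\<close>

lemma boxes_containing_point:
  assumes m: "m > 0" and P: "P \<in> topspace (Omega w)"
  shows "\<exists>k. \<forall>i. P \<in> orbit_box w N m i \<longrightarrow> orbit_box w N m i = orbit_box w N m k \<or> orbit_box w N m i = orbit_box w N m (k + 1)"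
proof -
  obtain x t where x: "P = suspension_class w (x, t)" "x \<in> Theta w"
    using P unfolding topspace_Omega by blast
  define l where "l = \<lfloor>of_nat m * t\<rfloor>"
  \<comment> \<open>One letter more than \<open>N\<close>, because the upper of the two boxes may
    belong to the next letter, which moves the window by one.\<close>
  obtain d where d: "agree (N + 1) (translate (l div int m) x) (translate d w)"
    using translate_Theta[OF x(2)] unfolding Theta_iff by blast
  define k where "k = d * int m + l mod int m"
  have k: "k = (d - l div int m) * int m + l"
    by (simp add: k_def algebra_simps)
  have "orbit_box w N m i = orbit_box w N m k \<or> orbit_box w N m i = orbit_box w N m (k + 1)" if i: "P \<in> orbit_box w N m i" for i
  proof -
    obtain n where n: "agree N (translate (i div int m) w) (translate n x)"
      "\<bar>of_nat m * t - of_int (n * int m + i mod int m)\<bar> < 1"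
      using i unfolding x(1) suspension_class_in_box[OF x(2) m] by blast
    \<comment> \<open>Relative to the integer part \<open>l\<close> of the height, the centre of a
      box through the point is at \<open>l\<close> or \<open>l + 1\<close>. The same offset from
      \<open>k\<close> gives an orbit box with the same remainder and the same window.\<close>
    define \<delta> where "\<delta> = n * int m + i mod int m - l"
    have \<delta>: "\<delta> = 0 \<or> \<delta> = 1"
      using n(2) unfolding \<delta>_def l_def by linarith
    have e: "n * int m + i mod int m = l + \<delta>" by (simp add: \<delta>_def)
    have ldiv: "(l + \<delta>) div int m = n" and lmod: "(l + \<delta>) mod int m = i mod int m"
      unfolding e[symmetric] using m by simp_all
    have kd: "(k + \<delta>) div int m = d - l div int m + n" "(k + \<delta>) mod int m = i mod int m"
      unfolding k add.assoc using m ldiv lmod by simp_all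
    have "\<bar>n - l div int m\<bar> \<le> 1"
    proof -
      have "l div int m \<le> (l + \<delta>) div int m" "(l + \<delta>) div int m \<le> (l + int m) div int m"
        by (rule zdiv_mono1; use \<delta> m in auto)+
      then show ?thesis using ldiv m by simp
    qed
    then have "agree N (translate (n - l div int m) (translate (l div int m) x))
        (translate (n - l div int m) (translate d w))"
      by (intro agree_translate[OF d]) simp
    then have "agree N (translate n x) (translate ((k + \<delta>) div int m) w)"
      unfolding kd by (simp add: algebra_simps)
    then have "agree N (translate (i div int m) w) (translate ((k + \<delta>) div int m) w)"
      using n(1) agree_trans by blast
    then have "orbit_box w N m i = orbit_box w N m (k + \<delta>)"
      by (rule orbit_box_eqI) (simp add: kd)
    then show ?thesis using \<delta> by (metis add_0_right)
  qed
  then show ?thesis by blast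
qed

text \<open>The orbit point of \<open>w\<close> halfway in time between the two centres lies in both
  boxes.\<close>

lemma consecutive_boxes_meet:
  assumes m: "m > 0"
  shows "orbit_box w N m k \<inter> orbit_box w N m (k + 1) \<noteq> {}"
proof -
  define t where "t = (of_int k + 1 / 2) / real m"
  have t: "of_nat m * t = of_int k + 1 / 2" using m by (simp add: t_def)
  have "suspension_class w (w, t) \<in> orbit_box w N m i" if "i = k \<or> i = k + 1" for i
    unfolding suspension_class_in_box[OF self_in_Theta m] t
    by (rule exI[of _ "i div int m"]) (use that in auto)
  then show ?thesis by blast
qed

text \<open>The centre of one box lies in the other. Both heights are multiples of
  \<open>1 / m\<close> and differ by less than \<open>1 / m\<close>, hence coincide.\<close>

lemma orbit_box_eqD:
  assumes m: "m > 0" and eq: "orbit_box w N m i = orbit_box w N m i'"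
  shows "i mod int m = i' mod int m" "agree N (translate (i div int m) w) (translate (i' div int m) w)"
proof -
  have "suspension_class w (w, of_int i / of_nat m) \<in> orbit_box w N m i"
    unfolding suspension_class_in_box[OF self_in_Theta m]
    by (rule exI[of _ "i div int m"]) (use m in simp)
  then obtain n where n: "agree N (translate (i' div int m) w) (translate n w)"
    "\<bar>of_nat m * (of_int i / of_nat m) - of_int (n * int m + i' mod int m)\<bar> < (1::real)"
    unfolding eq suspension_class_in_box[OF self_in_Theta m] by blast
  have "\<bar>of_int (i - (n * int m + i' mod int m))\<bar> < (1::real)"
    using n(2) m by simp
  then have i: "i = n * int m + i' mod int m" by linarith
  then have "i div int m = n" "i mod int m = i' mod int m"
    using m by simp_all
  then show "i mod int m = i' mod int m" "agree N (translate (i div int m) w) (translate (i' div int m) w)"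
    using n(1) agree_sym by auto
qed

text \<open>The radius of a box in time equals the Lebesgue number \<open>1 / m\<close>, and its
  central height is a multiple of \<open>1 / m\<close> in the unit interval.\<close>

lemma boxes_refine:
  fixes w :: "int \<Rightarrow> letter"
  assumes "open_cover (Omega w) \<U>"
  shows "\<exists>N m p. m > 0 \<and> refinement_map (range (orbit_box w N m)) \<U> p"
proof -
  obtain N m where m: "m > (0::nat)" and G: "\<forall>x\<in>Theta w. \<forall>t\<in>{0..1}. \<exists>G\<in>\<U>. \<forall>y\<in>Theta w. \<forall>s.
      agree N x y \<and> \<bar>s - t\<bar> < 1 / m \<longrightarrow> suspension_class w (y, s) \<in> G"
    using Omega_Lebesgue_number[OF assms] by (elim exE conjE) (rule that)
  have "\<exists>G\<in>\<U>. orbit_box w N m i \<subseteq> G" for i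
  proof -
    define t where "t = of_int (i mod int m) / real m"
    have "i mod int m \<ge> 0" "i mod int m < int m" using m by simp_all
    then have "0 \<le> real_of_int (i mod int m)" "real_of_int (i mod int m) \<le> real m" by linarith+
    then have t: "t \<in> {0..1}" using m by (simp add: t_def)
    obtain G where G: "G \<in> \<U>" "\<forall>y\<in>Theta w. \<forall>s. agree N (translate (i div int m) w) y \<and>
        \<bar>s - t\<bar> < 1 / m \<longrightarrow> suspension_class w (y, s) \<in> G"
      using bspec[OF bspec[OF G translate_Theta[OF self_in_Theta, of "i div int m"]] t]
      by (elim bexE) (rule that)
    have "\<bar>s - t\<bar> < 1 / m" if "s \<in> {(of_int (i mod int m) - 1) / real m<..<(of_int (i mod int m) + 1) / real m}" for s
      using that by (simp add: t_def abs_less_iff add_divide_distrib diff_divide_distrib)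
    then have "orbit_box w N m i \<subseteq> G"
      unfolding orbit_box_def cell_def using G(2) by blast
    then show ?thesis using G(1) by blast
  qed
  then obtain p where "refinement_map (range (orbit_box w N m)) \<U> p"
    using refinement_map_ex[of "range (orbit_box w N m)" \<U>] by blast
  then show ?thesis using m by blast
qed

text \<open>The refinement map that shortens windows from \<open>M\<close> to \<open>N\<close> at
  fixed \<open>m\<close>. A box is a set without a preferred index, hence the choice; the result
  does not depend on it when \<open>m > 0\<close> and \<open>N \<le> M\<close>.\<close>

definition rebox :: "(int \<Rightarrow> 'a) \<Rightarrow> nat \<Rightarrow> nat \<Rightarrow> nat \<Rightarrow> ((int \<Rightarrow> 'a) \<times> real) set set \<Rightarrow> ((int \<Rightarrow> 'a) \<times> real) set set" where
  "rebox w M N m B = orbit_box w N m (SOME i. orbit_box w M m i = B)"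

lemma rebox_box:
  assumes "m > 0" "N \<le> M"
  shows "rebox w M N m (orbit_box w M m i) = orbit_box w N m i"
proof -
  define i' where "i' = (SOME i'. orbit_box w M m i' = orbit_box w M m i)"
  have "orbit_box w M m i' = orbit_box w M m i"
    unfolding i'_def by (rule someI[of "\<lambda>i'. orbit_box w M m i' = orbit_box w M m i" i]) simp
  then have "orbit_box w N m i' = orbit_box w N m i"
    by (intro orbit_box_eqI[OF agree_mono[OF orbit_box_eqD(2)[OF assms(1)] assms(2)]
          orbit_box_eqD(1)[OF assms(1)]])
  then show ?thesis by (simp add: rebox_def i'_def)
qed

lemma rebox_refinement_map:
  assumes "m > 0" "N \<le> M"
  shows "refinement_map (range (orbit_box w M m)) (range (orbit_box w N m)) (rebox w M N m)"
  unfolding refinement_map_def using rebox_box[OF assms] orbit_box_mono[OF assms(2)] by fastforce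


section \<open>The cohomology of the suspension space\<close>

text \<open>The case \<open>l = m\<close> is included: it is the first box of the next letter,
  reached by the last edge of the current one. The extra letter in the window pays for this
  shift.\<close>

lemma orbit_box_add:
  assumes m: "m > 0" and l: "l \<le> m" and agr: "agree (N + 1) (translate n w) (translate n' w)"
  shows "orbit_box w N m (n * int m + int l) = orbit_box w N m (n' * int m + int l)"
proof (rule orbit_box_eqI)
  have d: "(k * int m + int l) div int m = k + int l div int m" for k
    using m by simp
  have "int l div int m \<le> int m div int m"
    using l m by (intro zdiv_mono1) auto
  moreover have "0 \<le> int l div int m"
    using m by (simp add: pos_imp_zdiv_nonneg_iff)
  ultimately have "\<bar>int l div int m\<bar> \<le> 1"
    using m by simp
  then have "agree N (translate (int l div int m) (translate n w)) (translate (int l div int m) (translate n' w))"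
    by (intro agree_translate[OF agr]) simp
  then show "agree N (translate ((n * int m + int l) div int m) w) (translate ((n' * int m + int l) div int m) w)"
    unfolding d by (simp add: add.commute)
qed simp

lemma cochains_degenerate:
  assumes "c \<in> cochains \<U> n" "i \<le> n" "j \<le> n" "i \<noteq> j" "s ! i = s ! j"
  shows "c s = 0"
proof (cases "s \<in> nerve_simplices \<U> n")
  case True
  then have "s[i := s ! j, j := s ! i] = s"
    using assms(5) by (metis list_update_id)
  then show ?thesis
    using cochains_swap[OF assms(1) True assms(2-4)] by simp
qed (use assms in \<open>simp add: cochains_eq_0\<close>)

lemma nerve_orbit_box:
  assumes m: "m > 0" and s: "s \<in> nerve_simplices (range (orbit_box w N m)) n"
  shows "\<exists>k. set s \<subseteq> {orbit_box w N m k, orbit_box w N m (k + 1)}"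
proof -
  obtain P where P: "P \<in> \<Inter>(set s)" and sub: "set s \<subseteq> range (orbit_box w N m)" and "length s = Suc n"
    using s unfolding nerve_simplices_def by blast
  then obtain B where "B \<in> set s"
    by (metis length_Suc_conv list.set_intros(1))
  then have "P \<in> topspace (Omega w)"
    using P sub openin_subset[OF openin_orbit_box] by blast
  then obtain k where "\<And>i. P \<in> orbit_box w N m i \<Longrightarrow>
      orbit_box w N m i = orbit_box w N m k \<or> orbit_box w N m i = orbit_box w N m (k + 1)"
    using boxes_containing_point[OF m] by blast
  then show ?thesis
    using P sub by blast
qed

text \<open>Among three vertices taken from two boxes two coincide, and alternation then forces the
  value 0.\<close>

lemma cochains_orbit_box_trivial:
  assumes m: "m > 0" and n: "n \<ge> 2"
  shows "cochains (range (orbit_box w N m)) n \<subseteq> {\<lambda>_. 0}"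
proof
  fix c assume c: "c \<in> cochains (range (orbit_box w N m)) n"
  have "c s = 0" for s
  proof (cases "s \<in> nerve_simplices (range (orbit_box w N m)) n")
    case True
    then obtain k where k: "set s \<subseteq> {orbit_box w N m k, orbit_box w N m (k + 1)}"
      using nerve_orbit_box[OF m] by blast
    have "length s = Suc n" using True by (simp add: nerve_simplices_def)
    then have "s ! i = orbit_box w N m k \<or> s ! i = orbit_box w N m (k + 1)" if "i \<le> 2" for i
      using that n subsetD[OF k, of "s ! i"] by simp
    from this[of 0] this[of 1] this[of 2]
    have "s ! 0 = s ! 1 \<or> s ! 0 = s ! 2 \<or> s ! 1 = s ! 2"
      by auto
    then show ?thesis
    proof (elim disjE)
      show "s ! 0 = s ! 1 \<Longrightarrow> c s = 0"
        by (rule cochains_degenerate[OF c, of 0 1]) (use n in simp_all)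
      show "s ! 0 = s ! 2 \<Longrightarrow> c s = 0"
        by (rule cochains_degenerate[OF c, of 0 2]) (use n in simp_all)
      show "s ! 1 = s ! 2 \<Longrightarrow> c s = 0"
        by (rule cochains_degenerate[OF c, of 1 2]) (use n in simp_all)
    qed
  qed (use c in \<open>simp add: cochains_eq_0\<close>)
  then show "c \<in> {\<lambda>_. 0}" by blast
qed

lemma cocycles_0_orbit_box:
  assumes m: "m > 0" and c: "c \<in> cocycles (range (orbit_box w N m)) 0"
  shows "\<exists>r. c = (\<lambda>s. if s \<in> nerve_simplices (range (orbit_box w N m)) 0 then r else 0)"
proof -
  have step: "c [orbit_box w N m k] = c [orbit_box w N m (k + 1)]" for k
    by (rule cocycles_0_eq[OF c]) (use consecutive_boxes_meet[OF m] in auto)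
  have "c [orbit_box w N m k] = c [orbit_box w N m 0]" for k
  proof (induction k rule: int_induct[of _ 0])
    case (step2 i)
    then show ?case using step[of "i - 1"] by simp
  qed (use step in simp_all)
  then have "c s = (if s \<in> nerve_simplices (range (orbit_box w N m)) 0 then c [orbit_box w N m 0] else 0)" for s
    using c by (auto simp: nerve_simplices_0 cocycles_def cochains_def)
  then show ?thesis by blast
qed

text \<open>A primitive along the index line becomes a 0-cochain as soon as it depends only on the
  finer box and not on the index. Every edge of the finer nerve joins boxes \<open>k\<close> and
  \<open>k + 1\<close> up to order and repetition, so alternation reduces all cases to the step
  relation.\<close>

lemma pull_rebox_coboundary:
  assumes m: "m > 0" and NM: "N \<le> M" and z: "z \<in> cochains (range (orbit_box w N m)) (Suc 0)"
    and step: "\<And>i. H (i + 1) - H i = z [orbit_box w N m i, orbit_box w N m (i + 1)]"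
    and H: "\<And>i i'. orbit_box w M m i = orbit_box w M m i' \<Longrightarrow> H i = H i'"
  shows "pull_cochain (range (orbit_box w M m)) (Suc 0) (rebox w M N m) z
    \<in> coboundaries (range (orbit_box w M m)) (Suc 0)"
proof -
  let ?W = "range (orbit_box w M m)"
  define h where "h s = (if s \<in> nerve_simplices ?W 0 then H (SOME i. orbit_box w M m i = s ! 0) else 0)" for s
  have ne: "orbit_box w M m i \<noteq> {}" for i
    using consecutive_boxes_meet[OF m] by blast
  have h: "h [orbit_box w M m i] = H i" for i
  proof -
    have "orbit_box w M m (SOME i'. orbit_box w M m i' = orbit_box w M m i) = orbit_box w M m i"
      by (rule someI[of "\<lambda>i'. orbit_box w M m i' = orbit_box w M m i" i]) simp
    moreover have "[orbit_box w M m i] \<in> nerve_simplices ?W 0"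
      using ne by (auto simp: nerve_simplices_0)
    ultimately show ?thesis
      using H[of "SOME i'. orbit_box w M m i' = orbit_box w M m i" i] by (simp add: h_def)
  qed
  have "pull_cochain ?W (Suc 0) (rebox w M N m) z s = coboundary ?W 0 h s" for s
  proof (cases "s \<in> nerve_simplices ?W (Suc 0)")
    case True
    then obtain A B where AB: "s = [A, B]"
      by (auto simp: nerve_simplices_1)
    obtain k where k: "A = orbit_box w M m k \<or> A = orbit_box w M m (k + 1)"
      "B = orbit_box w M m k \<or> B = orbit_box w M m (k + 1)"
      using nerve_orbit_box[OF m True] AB by auto
    have 1: "pull_cochain ?W (Suc 0) (rebox w M N m) z s = z [rebox w M N m A, rebox w M N m B]"
      using True AB by (simp add: pull_cochain_def)
    have 2: "coboundary ?W 0 h s = h [B] - h [A]"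
      using True AB by (simp add: coboundary_0_eq)
    have diag: "z [C, C] = 0" for C
      by (rule cochains_degenerate[OF z, of 0 1]) simp_all
    have "[orbit_box w N m k, orbit_box w N m (k + 1)] \<in> nerve_simplices (range (orbit_box w N m)) (Suc 0)"
      by (rule nerve_simplices_1[THEN iffD2], rule bexI[of _ "orbit_box w N m k"],
          rule bexI[of _ "orbit_box w N m (k + 1)"]) (simp_all add: consecutive_boxes_meet[OF m])
    then have swap: "z [orbit_box w N m (k + 1), orbit_box w N m k] = - z [orbit_box w N m k, orbit_box w N m (k + 1)]"
      using cochains_swap[OF z, of "[orbit_box w N m k, orbit_box w N m (k + 1)]" 0 1] by simp
    show ?thesis
      unfolding 1 2 using k
      by (elim disjE) (simp_all add: h rebox_box[OF m NM] diag swap flip: step)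
  qed (simp add: pull_cochain_def coboundary_def)
  then have "pull_cochain ?W (Suc 0) (rebox w M N m) z = coboundary ?W 0 h" by blast
  moreover have "h \<in> cochains ?W 0"
    by (simp add: cochains_0_iff h_def)
  ultimately show ?thesis by (simp add: coboundaries_def)
qed

text \<open>The total \<open>\<phi> k n\<close> of \<open>z k\<close> over the \<open>m\<close>
  edges of one letter is a local function of \<open>n\<close>. A primitive of a combination of these
  totals fixes the values at the first box of each letter; partial sums over the edges fill in the
  rest.\<close>

lemma three_cochains_dependent:
  fixes w :: "int \<Rightarrow> letter"
    and z :: "nat \<Rightarrow> ((int \<Rightarrow> letter) \<times> real) set set list \<Rightarrow> rat"
  assumes w: "uniformly_recurrent w" "two_block w" and m: "m > 0"
    and z: "\<And>k. z k \<in> cochains (range (orbit_box w N m)) (Suc 0)"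
  shows "\<exists>a b c. (a \<noteq> 0 \<or> b \<noteq> 0 \<or> c \<noteq> 0) \<and>
    cech_null (Omega w) (Suc 0) (range (orbit_box w N m)) (\<lambda>s. a * z 0 s + b * z 1 s + c * z 2 s)"
proof -
  define \<zeta> where "\<zeta> k i = z k [orbit_box w N m i, orbit_box w N m (i + 1)]" for k i
  define \<phi> where "\<phi> k n = (\<Sum>l<m. \<zeta> k (n * int m + int l))" for k n
  have \<zeta>: "\<zeta> k (n * int m + int l) = \<zeta> k (n' * int m + int l)"
    if "l < m" "agree (N + 1) (translate n w) (translate n' w)" for k n n' l
    using orbit_box_add[OF m _ that(2), of l] orbit_box_add[OF m _ that(2), of "Suc l"] that(1)
    by (simp add: \<zeta>_def add.assoc add.commute)
  have "local_function w (N + 1) (\<phi> k)" for k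
    unfolding local_function_def \<phi>_def
    by (intro allI impI sum.cong refl \<zeta>) simp_all
  from three_local_functions_dependent[where \<phi> = \<phi>, OF w this]
  obtain a b c \<psi> M' where abc: "a \<noteq> 0 \<or> b \<noteq> 0 \<or> c \<noteq> 0" and \<psi>: "local_function w M' \<psi>"
    "\<forall>n. \<psi> (n + 1) - \<psi> n = a * \<phi> 0 n + b * \<phi> 1 n + c * \<phi> 2 n"
    by (elim exE conjE) (rule that)
  define y where "y s = a * z 0 s + b * z 1 s + c * z 2 s" for s
  define \<eta> where "\<eta> i = a * \<zeta> 0 i + b * \<zeta> 1 i + c * \<zeta> 2 i" for i
  have \<eta>: "\<eta> i = y [orbit_box w N m i, orbit_box w N m (i + 1)]" for i
    by (simp add: \<eta>_def y_def \<zeta>_def)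
  have "(\<lambda>s. 1 * (a * z 0 s + b * z 1 s) + c * z 2 s) \<in> cochains (range (orbit_box w N m)) (Suc 0)"
    by (intro cochains_lincomb z)
  then have y: "y \<in> cochains (range (orbit_box w N m)) (Suc 0)"
    by (simp add: y_def[abs_def])
  have \<psi>sum: "\<psi> (n + 1) - \<psi> n = (\<Sum>l<m. \<eta> (n * int m + int l))" for n
    unfolding spec[OF \<psi>(2)] \<phi>_def \<eta>_def by (simp add: sum.distrib sum_distrib_left)
  \<comment> \<open>The value \<psi> at the start of the letter plus the edges already traversed in
    it. Crossing into the next letter completes the sum, and \<open>\<psi>sum\<close> absorbs
    it.\<close>
  define H where "H i = \<psi> (i div int m) + (\<Sum>l<nat (i mod int m). \<eta> (i div int m * int m + int l))" for i
  have Hnr: "H (n * int m + int r) = \<psi> n + (\<Sum>l<r. \<eta> (n * int m + int l))" if "r < m" for n r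
  proof -
    have "(n * int m + int r) div int m = n" "(n * int m + int r) mod int m = int r"
      using that by simp_all
    then show ?thesis by (simp only: H_def nat_int)
  qed
  have Hstep: "H (i + 1) - H i = \<eta> i" for i
  proof -
    define n r where "n = i div int m" and "r = nat (i mod int m)"
    have "0 \<le> i mod int m" "i mod int m < int m" using m by simp_all
    then have r: "r < m" and i: "i = n * int m + int r"
      by (simp_all add: r_def n_def nat_less_iff)
    show ?thesis
    proof (cases "Suc r < m")
      case True
      then have "H (i + 1) = \<psi> n + (\<Sum>l<Suc r. \<eta> (n * int m + int l))"
        using Hnr[of "Suc r" n] by (simp add: i add.assoc add.commute)
      then show ?thesis using Hnr[OF r, of n] i by simp
    next
      case False
      then have mr: "m = Suc r" using r by simp
      have "i + 1 = (n + 1) * int m + int 0"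
        by (simp add: i mr algebra_simps)
      then have "H (i + 1) = \<psi> (n + 1)"
        using Hnr[OF m, of "n + 1"] by simp
      then show ?thesis
        using Hnr[OF r, of n] \<psi>sum[of n] i by (simp add: mr)
    qed
  qed
  \<comment> \<open>Large enough to determine \<psi>, which needs \<open>M'\<close>, and the edges
    within a letter, which need \<open>N + 1\<close>.\<close>
  define M where "M = max M' (N + 1)"
  have Hwd: "H i = H i'" if eq: "orbit_box w M m i = orbit_box w M m i'" for i i'
  proof -
    have agr: "agree M (translate (i div int m) w) (translate (i' div int m) w)"
      and md: "i mod int m = i' mod int m"
      using orbit_box_eqD[OF m eq] by auto
    have "\<psi> (i div int m) = \<psi> (i' div int m)"
      by (rule local_functionD[OF \<psi>(1) agree_mono[OF agr]]) (simp add: M_def)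
    moreover have "\<eta> (i div int m * int m + int l) = \<eta> (i' div int m * int m + int l)" if "l < m" for l
      unfolding \<eta>_def using \<zeta>[OF that agree_mono[OF agr]] by (simp add: M_def)
    moreover have "l < m" if "l < nat (i' mod int m)" for l
    proof -
      have "i' mod int m < int m" using m by simp
      then show ?thesis using that by linarith
    qed
    ultimately show ?thesis
      unfolding H_def md by (intro arg_cong2[where f = "(+)"] sum.cong) auto
  qed
  have NM: "N \<le> M" by (simp add: M_def)
  have "pull_cochain (range (orbit_box w M m)) (Suc 0) (rebox w M N m) y
    \<in> coboundaries (range (orbit_box w M m)) (Suc 0)"
    by (rule pull_rebox_coboundary[where H = H, OF m NM y _ Hwd]) (simp_all only: Hstep \<eta>)
  then have "cech_null (Omega w) (Suc 0) (range (orbit_box w N m)) y"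
    unfolding cech_null_def using open_cover_boxes[OF m] rebox_refinement_map[OF m NM] by blast
  then show ?thesis
    using abc unfolding y_def[abs_def] by blast
qed

section \<open>The individual degrees and their direct sum\<close>

lemma H1_spanned_by_two:
  fixes w :: "int \<Rightarrow> letter"
  assumes w: "uniformly_recurrent w" "two_block w"
  defines "M \<equiv> cech_cohomology (Omega w) (Suc 0)"
  shows "\<exists>A\<in>carrier M. \<exists>B\<in>carrier M. \<forall>C\<in>carrier M. \<exists>a b. C = a \<odot>\<^bsub>M\<^esub> A \<oplus>\<^bsub>M\<^esub> b \<odot>\<^bsub>M\<^esub> B"
proof -
  interpret cech_degree "Omega w" "Suc 0"
    by unfold_locales (rule refinement_independent_1)
  show ?thesis
    unfolding M_def
  proof (rule spanned_by_two)
    fix A B C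
    assume carr: "A \<in> carrier (cech_cohomology (Omega w) (Suc 0))"
      "B \<in> carrier (cech_cohomology (Omega w) (Suc 0))" "C \<in> carrier (cech_cohomology (Omega w) (Suc 0))"
    obtain \<U> y where U: "open_cover (Omega w) \<U>" "\<And>k. y k \<in> cocycles \<U> (Suc 0)"
      "A = cls \<U> (y 0)" "B = cls \<U> (y 1)" "C = cls \<U> (y (2::nat))"
      using carrier_common_cover[OF carr] by metis
    obtain N m p where m: "m > 0" and p: "refinement_map (range (orbit_box w N m)) \<U> p"
      using boxes_refine[OF U(1)] by blast
    let ?W = "range (orbit_box w N m)"
    note W = open_cover_boxes[OF m, where w = w and N = N]
    define z where "z k = pull_cochain ?W (Suc 0) p (y k)" for k
    have z: "z k \<in> cocycles ?W (Suc 0)" for k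
      unfolding z_def using pull_cochain_cocycles[OF p U(2)] .
    then have "z k \<in> cochains ?W (Suc 0)" for k
      by (simp add: cocycles_def)
    from three_cochains_dependent[where z = z, OF w m this]
    obtain a b c where abc: "a \<noteq> 0 \<or> b \<noteq> 0 \<or> c \<noteq> 0"
      and null: "cech_null (Omega w) (Suc 0) ?W (\<lambda>s. a * z 0 s + b * z 1 s + c * z 2 s)"
      by (elim exE conjE) (rule that)
    have ABC: "A = cls ?W (z 0)" "B = cls ?W (z 1)" "C = cls ?W (z 2)"
      using cls_pull[OF U(1,2) W p] U(3-5) by (simp_all add: z_def)
    have 1: "(\<lambda>s. a * z 0 s + b * z 1 s) \<in> cocycles ?W (Suc 0)" "(\<lambda>s. c * z 2 s) \<in> cocycles ?W (Suc 0)"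
      using cocycles_lincomb[OF z z, of a 0 b 1] cocycles_lincomb[OF z z, of c 2 0 2] by simp_all
    then have d: "(\<lambda>s. a * z 0 s + b * z 1 s + c * z 2 s) \<in> cocycles ?W (Suc 0)"
      using cocycles_lincomb[OF 1, of 1 1] by simp
    have "(a \<odot>\<^bsub>coho\<^esub> A \<oplus>\<^bsub>coho\<^esub> b \<odot>\<^bsub>coho\<^esub> B) \<oplus>\<^bsub>coho\<^esub> c \<odot>\<^bsub>coho\<^esub> C
        = cls ?W (\<lambda>s. a * z 0 s + b * z 1 s + c * z 2 s)"
      unfolding ABC cls_lincomb[OF W z z] unfolding cls_smult[OF W z] by (rule cls_add[OF W 1])
    also have "\<dots> = cls ?W (\<lambda>_. 0)"
      using cls_eq_iff[OF W d zero_in_cocycles] null by simp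
    also have "\<dots> = \<zero>\<^bsub>coho\<^esub>"
      by (rule zero_eq_cls[OF W, symmetric])
    finally show "\<exists>a b c. (a \<noteq> 0 \<or> b \<noteq> 0 \<or> c \<noteq> 0) \<and>
      (a \<odot>\<^bsub>coho\<^esub> A \<oplus>\<^bsub>coho\<^esub> b \<odot>\<^bsub>coho\<^esub> B) \<oplus>\<^bsub>coho\<^esub> c \<odot>\<^bsub>coho\<^esub> C = \<zero>\<^bsub>coho\<^esub>"
      using abc by blast
  qed
qed

lemma H0_spanned_by_one:
  fixes w :: "int \<Rightarrow> letter"
  defines "M \<equiv> cech_cohomology (Omega w) 0"
  shows "\<exists>A\<in>carrier M. \<forall>C\<in>carrier M. \<exists>a. C = a \<odot>\<^bsub>M\<^esub> A"
proof -
  interpret cech_degree "Omega w" 0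
    by unfold_locales (rule refinement_independent_0)
  let ?T = "{topspace (Omega w)}"
  \<comment> \<open>The generator is the constant 1 on the one-set cover. That cover is refined by
    every other, so the generator pulls back to the constant 1 on each box cover.\<close>
  define e :: "((int \<Rightarrow> letter) \<times> real) set set list \<Rightarrow> rat" where
    "e s = (if s \<in> nerve_simplices ?T 0 then 1 else 0)" for s
  note T = open_cover_topspace
  have "coboundary ?T 0 e s = 0" for s
    by (cases "s \<in> nerve_simplices ?T (Suc 0)")
      (auto simp: coboundary_0_eq nerve_simplices_1 e_def coboundary_def)
  then have e: "e \<in> cocycles ?T 0"
    unfolding cocycles_def by (auto simp: cochains_0_iff e_def)
  have "\<exists>a. C = a \<odot>\<^bsub>M\<^esub> cls ?T e" if "C \<in> carrier M" for C
    using that unfolding M_def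
  proof (rule carrier_cases)
    fix \<U> y assume U: "open_cover (Omega w) \<U>" "y \<in> cocycles \<U> 0" "C = cls \<U> y"
    obtain N m p where m: "m > 0" and p: "refinement_map (range (orbit_box w N m)) \<U> p"
      using boxes_refine[OF U(1)] by blast
    let ?W = "range (orbit_box w N m)"
    note W = open_cover_boxes[OF m, where w = w and N = N]
    obtain r where r: "pull_cochain ?W 0 p y = (\<lambda>s. if s \<in> nerve_simplices ?W 0 then r else 0)"
      using cocycles_0_orbit_box[OF m pull_cochain_cocycles[OF p U(2)]] by blast
    obtain q where q: "refinement_map ?W ?T q"
      by (rule refinement_map_ex[of ?W ?T]) (use W in \<open>auto simp: open_cover_def\<close>)
    have re: "(\<lambda>s. r * e s) \<in> cocycles ?T 0"
      using cocycles_lincomb[OF e e, of r 0] by simp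
    have "pull_cochain ?W 0 q (\<lambda>s. r * e s) = (\<lambda>s. if s \<in> nerve_simplices ?W 0 then r else 0)"
      using nerve_simplices_map[OF q] by (auto simp: pull_cochain_def e_def)
    then have "cls ?T (\<lambda>s. r * e s) = cls \<U> y"
      using cls_pull[OF T re W q] cls_pull[OF U(1,2) W p] r by simp
    then have "C = r \<odot>\<^bsub>cech_cohomology (Omega w) 0\<^esub> cls ?T e"
      using U(3) by (simp add: cls_smult[OF T e])
    then show "\<exists>a. C = a \<odot>\<^bsub>cech_cohomology (Omega w) 0\<^esub> cls ?T e" by blast
  qed
  moreover have "cls ?T e \<in> carrier M"
    unfolding M_def by (rule cls_carrier[OF T e])
  ultimately show ?thesis by blast
qed

lemma cech_degree_Omega:
  fixes w :: "int \<Rightarrow> letter"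
  shows "cech_degree (Omega w) n"
proof
  show "refinement_independent (Omega w) n"
  proof (cases "n \<ge> 2")
    case True
    show ?thesis
    proof (rule refinement_independent_if_trivial_refinements)
      fix \<U> assume "open_cover (Omega w) \<U>"
      from boxes_refine[OF this] obtain N m p where m: "m > 0" "refinement_map (range (orbit_box w N m)) \<U> p"
        by blast
      then show "\<exists>\<W> p. open_cover (Omega w) \<W> \<and> refinement_map \<W> \<U> p \<and> cochains \<W> n \<subseteq> {\<lambda>_. 0}"
        by (intro exI[of _ "range (orbit_box w N m)"] exI[of _ p] conjI open_cover_boxes
            cochains_orbit_box_trivial[OF _ True])
    qed
  next
    case False
    then have "n = 0 \<or> n = Suc 0" by linarith
    then show ?thesis using refinement_independent_0 refinement_independent_1 by blast
  qed
qed

lemma Hn_trivial: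
  fixes w :: "int \<Rightarrow> letter"
  assumes n: "n \<ge> 2"
  shows "carrier (cech_cohomology (Omega w) n) = {\<zero>\<^bsub>cech_cohomology (Omega w) n\<^esub>}"
proof -
  interpret cech_degree "Omega w" n by (rule cech_degree_Omega)
  show ?thesis
  proof (rule carrier_trivial_if_null)
    fix \<U> y assume U: "open_cover (Omega w) \<U>" "y \<in> cocycles \<U> n"
    obtain N m p where m: "m > 0" and p: "refinement_map (range (orbit_box w N m)) \<U> p"
      using boxes_refine[OF U(1)] by blast
    show "cech_null (Omega w) n \<U> y"
      by (rule cech_null_if_trivial_refinement[OF open_cover_boxes[OF m] p cochains_orbit_box_trivial[OF m n]])
        (use U(2) in \<open>simp add: cocycles_def\<close>)
  qed
qed

theorem proposition5p19:
  fixes w :: "int \<Rightarrow> letter"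
  assumes "constructed_word w"
  shows "finitely_generated_module (ring_of_type_algebra :: rat ring)
           (total_cech_cohomology (Omega w))"
proof -
  obtain f u v g p s pos where "word_tower w f u v g p s pos"
    using constructed_word_tower[OF assms] .
  then have w: "uniformly_recurrent w" "two_block w"
    using word_tower.uniformly_recurrent word_tower.two_block by blast+
  define M where "M = cech_cohomology (Omega w)"
  have add0: "x \<oplus>\<^bsub>M n\<^esub> \<zero>\<^bsub>M n\<^esub> = x" "\<zero>\<^bsub>M n\<^esub> \<oplus>\<^bsub>M n\<^esub> x = x" if "x \<in> carrier (M n)" for x n
    using cech_degree.add_zero[OF cech_degree_Omega] that by (auto simp: M_def)
  have smult0: "r \<odot>\<^bsub>M n\<^esub> \<zero>\<^bsub>M n\<^esub> = \<zero>\<^bsub>M n\<^esub>" for r n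
    using cech_degree.smult_zero[OF cech_degree_Omega] by (simp add: M_def)
  have zc: "\<zero>\<^bsub>M n\<^esub> \<in> carrier (M n)" for n
    using cech_degree.zero_carrier[OF cech_degree_Omega] by (simp add: M_def)
  obtain A0 where A0: "A0 \<in> carrier (M 0)" "\<And>C. C \<in> carrier (M 0) \<Longrightarrow> \<exists>a. C = a \<odot>\<^bsub>M 0\<^esub> A0"
    using H0_spanned_by_one[of w] unfolding M_def by blast
  have "\<exists>A\<in>carrier (M 1). \<exists>B\<in>carrier (M 1). \<forall>C\<in>carrier (M 1). \<exists>a b. C = a \<odot>\<^bsub>M 1\<^esub> A \<oplus>\<^bsub>M 1\<^esub> b \<odot>\<^bsub>M 1\<^esub> B"
    unfolding M_def One_nat_def by (rule H1_spanned_by_two[OF w])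
  then obtain A1 B1 where A1: "A1 \<in> carrier (M 1)" "B1 \<in> carrier (M 1)"
    "\<forall>C\<in>carrier (M 1). \<exists>a b. C = a \<odot>\<^bsub>M 1\<^esub> A1 \<oplus>\<^bsub>M 1\<^esub> b \<odot>\<^bsub>M 1\<^esub> B1"
    by (elim bexE) (rule that)
  have high: "C = \<zero>\<^bsub>M n\<^esub>" if "C \<in> carrier (M n)" "n \<ge> 2" for C n
    using Hn_trivial[OF that(2), of w] that(1) by (simp add: M_def)
  \<comment> \<open>The inclusion of degree \<open>k\<close> into the direct sum. One generator from
    degree 0 and two from degree 1 suffice, as all higher degrees vanish.\<close>
  define \<iota> where "\<iota> k x n = (if n = k then x else \<zero>\<^bsub>M n\<^esub>)" for k x and n :: nat
  let ?S = "{\<iota> 0 A0, \<iota> 1 A1, \<iota> 1 B1}"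
  let ?D = "direct_sum_module M"
  have \<iota>: "\<iota> k x \<in> carrier ?D" if "x \<in> carrier (M k)" for k x
  proof -
    have "{n. \<iota> k x n \<noteq> \<zero>\<^bsub>M n\<^esub>} \<subseteq> {k}" by (auto simp: \<iota>_def)
    then have "finite {n. \<iota> k x n \<noteq> \<zero>\<^bsub>M n\<^esub>}" by (rule finite_subset) simp
    then show ?thesis using that zc by (simp add: direct_sum_module_def \<iota>_def)
  qed
  have "H = carrier ?D" if H: "submodule H (ring_of_type_algebra :: rat ring) ?D" "?S \<subseteq> H" for H
  proof
    interpret subgroup H "add_monoid ?D" using H(1) by (rule submodule.axioms(1))
    show "H \<subseteq> carrier ?D" using subset by simp
    have addH: "x \<oplus>\<^bsub>?D\<^esub> y \<in> H" if "x \<in> H" "y \<in> H" for x y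
      using m_closed[OF that] by simp
    have smultH: "r \<odot>\<^bsub>?D\<^esub> x \<in> H" if "x \<in> H" for r x
      using submodule.smult_closed[OF H(1) _ that, of r] by (simp add: ring_of_type_algebra_def)
    show "carrier ?D \<subseteq> H"
    proof
      fix x assume "x \<in> carrier ?D"
      then have x: "x n \<in> carrier (M n)" for n by (simp add: direct_sum_module_def)
      obtain r where r: "x 0 = r \<odot>\<^bsub>M 0\<^esub> A0" using A0(2)[OF x] by blast
      obtain a b where ab: "x 1 = a \<odot>\<^bsub>M 1\<^esub> A1 \<oplus>\<^bsub>M 1\<^esub> b \<odot>\<^bsub>M 1\<^esub> B1" using bspec[OF A1(3) x] by blast
      \<comment> \<open>The coefficients come from the components of \<open>x\<close> in degrees 0
        and 1. In each degree the summands included from other degrees contribute zero.\<close>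
      let ?y = "(r \<odot>\<^bsub>?D\<^esub> \<iota> 0 A0) \<oplus>\<^bsub>?D\<^esub> ((a \<odot>\<^bsub>?D\<^esub> \<iota> 1 A1) \<oplus>\<^bsub>?D\<^esub> (b \<odot>\<^bsub>?D\<^esub> \<iota> 1 B1))"
      have "x n = ?y n" for n
      proof -
        consider "n = 0" | "n = 1" | "n \<ge> 2" by linarith
        then show ?thesis
        proof cases
          case 1
          then show ?thesis
            using x[of 0] r zc add0 by (simp add: direct_sum_module_def \<iota>_def smult0)
        next
          case 2
          then show ?thesis
            using x[of 1] ab zc add0 by (simp add: direct_sum_module_def \<iota>_def smult0)
        next
          case 3
          then show ?thesis
            using high[OF x] zc add0 by (simp add: direct_sum_module_def \<iota>_def smult0)
        qed
      qed
      then have "x = ?y" by blast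
      moreover have "?y \<in> H" using H(2) by (intro addH smultH) auto
      ultimately show "x \<in> H" by simp
    qed
  qed
  moreover have "?S \<subseteq> carrier ?D" using \<iota> A0(1) A1(1,2) by blast
  ultimately show ?thesis
    unfolding finitely_generated_module_def total_cech_cohomology_def M_def[symmetric]
    by (intro exI[of _ ?S]) blast
qed

end
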